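(* Let $t\in\mathbb{N}$, let $f:2^\Omega\to\mathbb{R}$ be a set function with $\Omega=\{1,\dots,n\}$, and let $F$ be its multilinear extension. Then $f$ is $t$-sos-submodular if and only if the polynomial $G_1(x,y,s):=F(x)-F(y)+\sum_{i=1}^n(y_i-s_i)\cdot\frac{\partial F(x)}{\partial x_i}-\sum_{i=1}^n(x_i-s_i)\cdot\frac{\partial F(x+y-s)}{\partial x_i}$ is $(t+2)$-sos modulo $I_0[x,y,s]$.
   Context: $\mathbb{N}$ includes $0$. The multilinear extension (MLE) of a set function $f:2^\Omega\to\mathbb{R}$ is the unique multilinear polynomial $F\in\mathbb{R}[x_1,\dots,x_n]$ (every variable appears with power at most $1$ in every monomial) with $F(1_S)=f(S)$ for all $S\subseteq\Omega$, where $1_S\in\{0,1\}^n$ is the indicator vector of $S$. $\frac{\partial F(x+y-s)}{\partial x_i}$ denotes the partial derivative of $F$ with respect to its $i$-th argument, evaluated at the point $x+y-s$. For an ideal $I$ of a real polynomial ring, a polynomial $p$ is $t$-sos modulo $I$ if there are finitely many polynomials $q_1,\dots,q_m$ in that ring, each of degree at most $t$, with $p-\sum_{r=1}^m q_r^2\in I$. For $i\ne j$, $x_{-i,j}$ denotes the variables $x_1,\dots,x_n$ with $x_i,x_j$ removed, and $I_2[x_{-i,j}]=\langle x_k^2-x_k : k\neq i,j\rangle\subseteq\mathbb{R}[x_{-i,j}]$. The set function $f$ with MLE $F$ is $t$-sos-submodular if for all $i\neq j$ the polynomial $-\frac{\partial^2F(x)}{\partial x_i\partial x_j}$ (which does not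 involve $x_i,x_j$) is $t$-sos modulo $I_2[x_{-i,j}]$. With variables $x=(x_1,\dots,x_n)$, $y=(y_1,\dots,y_n)$, $s=(s_1,\dots,s_n)$, $I_0[x,y,s]=\langle\{x_i^2-x_i,\ x_iy_i-s_i,\ x_is_i-s_i,\ y_i^2-y_i,\ y_is_i-s_i,\ s_i^2-s_i\}_{i=1,\dots,n}\rangle\subseteq\mathbb{R}[x,y,s]$. *)

theory Defs
  imports Complex_Main "HOL-Library.Poly_Mapping"
begin

text \<open>
  A monomial maps each variable to its exponent, a polynomial maps each monomial to its
  coefficient; the ring structure is the one of \<^theory>\<open>HOL-Library.Poly_Mapping\<close>.
  The ring of polynomials in the variables \<open>V\<close> is the subset \<open>polys V\<close> of this type.
\<close>

type_synonym 'v mpoly = "('v \<Rightarrow>\<^sub>0 nat) \<Rightarrow>\<^sub>0 real"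

definition Const :: "real \<Rightarrow> 'v mpoly" where
  "Const c = Poly_Mapping.single 0 c"

definition Var :: "'v \<Rightarrow> 'v mpoly" where
  "Var v = Poly_Mapping.single (Poly_Mapping.single v 1) 1"

definition polys :: "'v set \<Rightarrow> 'v mpoly set" where
  "polys V = {p. \<forall>m\<in>Poly_Mapping.keys p. Poly_Mapping.keys m \<subseteq> V}"

definition mdegree :: "('v \<Rightarrow>\<^sub>0 nat) \<Rightarrow> nat" where
  "mdegree m = (\<Sum>v\<in>Poly_Mapping.keys m. Poly_Mapping.lookup m v)"

text \<open>The total degree, with the convention that the zero polynomial has degree 0.\<close>

definition total_degree :: "'v mpoly \<Rightarrow> nat" where
  "total_degree p = Max (insert 0 (mdegree ` Poly_Mapping.keys p))"

definition peval :: "('v \<Rightarrow> real) \<Rightarrow> 'v mpoly \<Rightarrow> real" where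
  "peval a p = (\<Sum>m\<in>Poly_Mapping.keys p. Poly_Mapping.lookup p m *
      (\<Prod>v\<in>Poly_Mapping.keys m. a v ^ Poly_Mapping.lookup m v))"

definition psubst :: "('v \<Rightarrow> 'w mpoly) \<Rightarrow> 'v mpoly \<Rightarrow> 'w mpoly" where
  "psubst \<sigma> p = (\<Sum>m\<in>Poly_Mapping.keys p. Const (Poly_Mapping.lookup p m) *
      (\<Prod>v\<in>Poly_Mapping.keys m. \<sigma> v ^ Poly_Mapping.lookup m v))"

text \<open>
  Formal partial derivative. A monomial in which \<open>v\<close> does not occur contributes 0, because of
  the factor \<open>lookup m v\<close>; so truncated subtraction of exponents does no harm.
\<close>

definition pdiff :: "'v \<Rightarrow> 'v mpoly \<Rightarrow> 'v mpoly" where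
  "pdiff v p = (\<Sum>m\<in>Poly_Mapping.keys p.
      Poly_Mapping.single (m - Poly_Mapping.single v 1)
        (Poly_Mapping.lookup p m * real (Poly_Mapping.lookup m v)))"

text \<open>
  The ideal generated by \<open>B\<close> in the ring \<open>polys V\<close> (for \<open>B \<subseteq> polys V\<close>): the multipliers are
  taken from that ring only.
\<close>

definition ideal_of :: "'v set \<Rightarrow> 'v mpoly set \<Rightarrow> 'v mpoly set" where
  "ideal_of V B = {\<Sum>b\<in>A. h b * b | A h. finite A \<and> A \<subseteq> B \<and> (\<forall>b\<in>A. h b \<in> polys V)}"

definition sos_mod :: "nat \<Rightarrow> 'v set \<Rightarrow> 'v mpoly set \<Rightarrow> 'v mpoly \<Rightarrow> bool" where
  "sos_mod t V I p \<longleftrightarrow>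
     (\<exists>qs. (\<forall>q\<in>set qs. q \<in> polys V \<and> total_degree q \<le> t) \<and> p - (\<Sum>q\<leftarrow>qs. q\<^sup>2) \<in> I)"

text \<open>
  Set functions on \<open>{1..n}\<close> are functions on \<^typ>\<open>nat set\<close>; only their values on subsets of
  \<open>{1..n}\<close> matter.
\<close>

definition multilinear :: "'v mpoly \<Rightarrow> bool" where
  "multilinear p \<longleftrightarrow> (\<forall>m\<in>Poly_Mapping.keys p. \<forall>v. Poly_Mapping.lookup m v \<le> 1)"

definition is_mle :: "nat \<Rightarrow> (nat set \<Rightarrow> real) \<Rightarrow> nat mpoly \<Rightarrow> bool" where
  "is_mle n f F \<longleftrightarrow> F \<in> polys {1..n} \<and> multilinear F \<and>
     (\<forall>S\<subseteq>{1..n}. peval (\<lambda>i. if i \<in> S then 1 else 0) F = f S)"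

text \<open>Well-defined by \<open>ex1_is_mle\<close> below.\<close>

definition mle :: "nat \<Rightarrow> (nat set \<Rightarrow> real) \<Rightarrow> nat mpoly" where
  "mle n f = (THE F. is_mle n f F)"

definition I2 :: "nat set \<Rightarrow> nat mpoly set" where
  "I2 V = ideal_of V ((\<lambda>k. (Var k)\<^sup>2 - Var k) ` V)"

definition sos_submodular :: "nat \<Rightarrow> nat \<Rightarrow> (nat set \<Rightarrow> real) \<Rightarrow> bool" where
  "sos_submodular t n f \<longleftrightarrow>
     (\<forall>i\<in>{1..n}. \<forall>j\<in>{1..n}. i \<noteq> j \<longrightarrow>
        sos_mod t ({1..n} - {i, j}) (I2 ({1..n} - {i, j})) (- pdiff i (pdiff j (mle n f))))"

text \<open>The variables \<open>x\<^sub>i\<close>, \<open>y\<^sub>i\<close>, \<open>s\<^sub>i\<close>.\<close>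

datatype xys = X nat | Y nat | S nat

abbreviation x :: "nat \<Rightarrow> xys mpoly" where "x i \<equiv> Var (X i)"
abbreviation y :: "nat \<Rightarrow> xys mpoly" where "y i \<equiv> Var (Y i)"
abbreviation s :: "nat \<Rightarrow> xys mpoly" where "s i \<equiv> Var (S i)"

definition xys_vars :: "nat \<Rightarrow> xys set" where
  "xys_vars n = X ` {1..n} \<union> Y ` {1..n} \<union> S ` {1..n}"

definition I0 :: "nat \<Rightarrow> xys mpoly set" where
  "I0 n = ideal_of (xys_vars n)
     (\<Union>i\<in>{1..n}. {(x i)\<^sup>2 - x i, x i * y i - s i, x i * s i - s i,
                    (y i)\<^sup>2 - y i, y i * s i - s i, (s i)\<^sup>2 - s i})"

definition G1 :: "nat \<Rightarrow> nat mpoly \<Rightarrow> xys mpoly" where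
  "G1 n F = psubst x F - psubst y F
     + (\<Sum>i=1..n. (y i - s i) * psubst x (pdiff i F))
     - (\<Sum>i=1..n. (x i - s i) * psubst (\<lambda>k. x k + y k - s k) (pdiff i F))"

hide_const (open) x y s X Y S


subsection \<open>Existence and uniqueness of the multilinear extension\<close>

lift_definition mono_of :: "nat set \<Rightarrow> (nat \<Rightarrow>\<^sub>0 nat)" is
  "\<lambda>U i. if finite U \<and> i \<in> U then 1 else 0"
  subgoal for U by (cases "finite U") auto
  done

lemma keys_mono_of: "finite U \<Longrightarrow> Poly_Mapping.keys (mono_of U) = U"
  by transfer auto

lemma lookup_mono_of:
  "finite U \<Longrightarrow> Poly_Mapping.lookup (mono_of U) i = (if i \<in> U then 1 else 0)"
  by transfer auto

lemma multilinear_monomial: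
  assumes "\<forall>v. Poly_Mapping.lookup m v \<le> 1"
  shows "m = mono_of (Poly_Mapping.keys m)"
proof (rule poly_mapping_eqI)
  fix k
  show "Poly_Mapping.lookup m k = Poly_Mapping.lookup (mono_of (Poly_Mapping.keys m)) k"
    using spec[OF assms, of k]
    by (auto simp: lookup_mono_of in_keys_iff le_Suc_eq)
qed

lemma keys_multilinear:
  assumes "F \<in> polys V" "multilinear F"
  shows "Poly_Mapping.keys F \<subseteq> mono_of ` Pow V"
proof
  fix m assume m: "m \<in> Poly_Mapping.keys F"
  then have "m = mono_of (Poly_Mapping.keys m)"
    using assms(2) by (intro multilinear_monomial) (auto simp: multilinear_def)
  moreover have "Poly_Mapping.keys m \<in> Pow V"
    using m assms(1) by (auto simp: polys_def)
  ultimately show "m \<in> mono_of ` Pow V" by blast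
qed

lemma inj_on_mono_of: "finite V \<Longrightarrow> inj_on mono_of (Pow V)"
  by (rule inj_on_inverseI[where g = Poly_Mapping.keys])
     (meson PowD finite_subset keys_mono_of)

lemma peval_indicator:
  assumes V: "finite V" and F: "Poly_Mapping.keys F \<subseteq> mono_of ` Pow V" and T: "T \<subseteq> V"
  shows "peval (\<lambda>i. if i \<in> T then 1 else 0) F =
           (\<Sum>U\<in>Pow T. Poly_Mapping.lookup F (mono_of U))"
proof -
  let ?a = "\<lambda>i. if i \<in> T then 1 else 0 :: real"
  let ?e = "\<lambda>m. \<Prod>v\<in>Poly_Mapping.keys m. ?a v ^ Poly_Mapping.lookup m v"
  have e: "?e (mono_of U) = (if U \<subseteq> T then 1 else 0)" if "U \<in> Pow V" for U
  proof -
    have U: "finite U" using that V finite_subset by blast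
    then have "?e (mono_of U) = (\<Prod>v\<in>U. ?a v)"
      by (simp add: keys_mono_of lookup_mono_of)
    also have "\<dots> = (if U \<subseteq> T then 1 else 0)"
      using U by (auto intro!: prod.neutral)
    finally show ?thesis .
  qed
  have "peval ?a F = (\<Sum>m\<in>mono_of ` Pow V. Poly_Mapping.lookup F m * ?e m)"
    unfolding peval_def using F V
    by (intro sum.mono_neutral_left) (auto simp: in_keys_iff)
  also have "\<dots> = (\<Sum>U\<in>Pow V. Poly_Mapping.lookup F (mono_of U) * ?e (mono_of U))"
    by (simp add: sum.reindex inj_on_mono_of V)
  also have "\<dots> = (\<Sum>U\<in>Pow V. if U \<subseteq> T then Poly_Mapping.lookup F (mono_of U) else 0)"
    by (intro sum.cong refl) (simp add: e del: Pow_iff)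
  also have "\<dots> = (\<Sum>U\<in>Pow T. Poly_Mapping.lookup F (mono_of U))"
    using V T by (intro sum.mono_neutral_cong_right) auto
  finally show ?thesis .
qed

lemma ex_moebius:
  assumes "finite V"
  shows "\<exists>g :: 'a set \<Rightarrow> real. \<forall>T\<subseteq>V. (\<Sum>U\<in>Pow T. g U) = f T"
  using assms
proof (induction V arbitrary: f rule: finite_induct)
  case empty
  show ?case by (intro exI[of _ f]) auto
next
  case (insert a V)
  obtain g1 :: "'a set \<Rightarrow> real" where g1: "\<forall>T\<subseteq>V. (\<Sum>U\<in>Pow T. g1 U) = f T"
    using insert.IH by blast
  obtain g2 :: "'a set \<Rightarrow> real"
    where g2: "\<forall>T\<subseteq>V. (\<Sum>U\<in>Pow T. g2 U) = f (insert a T) - f T"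
    using insert.IH[of "\<lambda>T. f (insert a T) - f T"] by blast
  define g where "g U = (if a \<in> U then g2 (U - {a}) else g1 U)" for U
  have old: "(\<Sum>U\<in>Pow T. g U) = f T" if "T \<subseteq> V" for T
  proof -
    have "(\<Sum>U\<in>Pow T. g U) = (\<Sum>U\<in>Pow T. g1 U)"
      using that insert.hyps by (intro sum.cong refl) (auto simp: g_def)
    then show ?thesis using g1 that by simp
  qed
  have new: "(\<Sum>U\<in>Pow (insert a T). g U) = f (insert a T)" if T: "T \<subseteq> V" for T
  proof -
    have fin: "finite T" and a: "a \<notin> T"
      using T insert.hyps finite_subset by blast+
    have "(\<Sum>U\<in>Pow (insert a T). g U) = (\<Sum>U\<in>Pow T. g U) + (\<Sum>U\<in>insert a ` Pow T. g U)"
      unfolding Pow_insert using fin a by (intro sum.union_disjoint) auto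
    also have "(\<Sum>U\<in>insert a ` Pow T. g U) = (\<Sum>U\<in>Pow T. g (insert a U))"
      using a by (subst sum.reindex) (auto simp: inj_on_def)
    also have "\<dots> = (\<Sum>U\<in>Pow T. g2 U)"
      using a by (intro sum.cong refl) (auto simp: g_def intro!: arg_cong[where f = g2])
    finally show ?thesis using old[OF T] g2 T by simp
  qed
  have "(\<Sum>U\<in>Pow T. g U) = f T" if "T \<subseteq> insert a V" for T
  proof (cases "a \<in> T")
    case True
    then have "T = insert a (T - {a})" by blast
    moreover have "T - {a} \<subseteq> V" using that by blast
    ultimately show ?thesis using new by metis
  next
    case False
    then show ?thesis using that old by blast
  qed
  then show ?case by blast
qed

lemma moebius_unique:
  fixes g h :: "'a set \<Rightarrow> real"
  assumes "finite V" "\<And>T. T \<subseteq> V \<Longrightarrow> (\<Sum>U\<in>Pow T. g U) = (\<Sum>U\<in>Pow T. h U)" "T \<subseteq> V"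
  shows "g T = h T"
proof -
  have "finite T" using assms finite_subset by blast
  then show ?thesis using assms(3)
  proof (induction T rule: finite_psubset_induct)
    case (psubset T)
    have "(\<Sum>U\<in>Pow T - {T}. g U) = (\<Sum>U\<in>Pow T - {T}. h U)"
      using psubset by (intro sum.cong refl psubset.IH) auto
    moreover have "(\<Sum>U\<in>Pow T. k U) = k T + (\<Sum>U\<in>Pow T - {T}. k U)" for k :: "'a set \<Rightarrow> real"
      using psubset.hyps by (intro sum.remove) auto
    ultimately show ?case using assms(2)[OF psubset.prems] by simp
  qed
qed

lemma ex1_is_mle: "\<exists>!F. is_mle n f F"
proof (rule ex_ex1I)
  obtain g where g: "\<forall>T\<subseteq>{1..n}. (\<Sum>U\<in>Pow T. g U) = f T"
    using ex_moebius[of "{1..n}" f] by auto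
  define F :: "nat mpoly"
    where "F = Abs_poly_mapping (\<lambda>m. if m \<in> mono_of ` Pow {1..n} then g (Poly_Mapping.keys m) else 0)"
  have lookup_F: "Poly_Mapping.lookup F m =
      (if m \<in> mono_of ` Pow {1..n} then g (Poly_Mapping.keys m) else 0)" for m
    unfolding F_def
    by (subst lookup_Abs_poly_mapping)
       (auto intro: finite_subset[where B = "mono_of ` Pow {1..n}"])
  have keys_F: "Poly_Mapping.keys F \<subseteq> mono_of ` Pow {1..n}"
    by (auto simp: in_keys_iff lookup_F split: if_splits)
  have fin: "finite U" if "U \<subseteq> {1..n}" for U
    using that finite_subset by blast
  have "F \<in> polys {1..n}"
    using keys_F by (force simp: polys_def keys_mono_of fin)
  moreover have "multilinear F"
    using keys_F by (force simp: multilinear_def lookup_mono_of fin)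
  moreover have "peval (\<lambda>i. if i \<in> T then 1 else 0) F = f T" if T: "T \<subseteq> {1..n}" for T
  proof -
    have "peval (\<lambda>i. if i \<in> T then 1 else 0) F = (\<Sum>U\<in>Pow T. Poly_Mapping.lookup F (mono_of U))"
      using keys_F T by (intro peval_indicator) auto
    also have "\<dots> = (\<Sum>U\<in>Pow T. g U)"
    proof (intro sum.cong refl)
      fix U assume "U \<in> Pow T"
      then have "U \<in> Pow {1..n}" using T by blast
      then show "Poly_Mapping.lookup F (mono_of U) = g U"
        by (simp add: lookup_F keys_mono_of fin)
    qed
    finally show ?thesis using g T by simp
  qed
  ultimately show "\<exists>F. is_mle n f F"
    unfolding is_mle_def by blast
next
  fix F G assume "is_mle n f F" "is_mle n f G"
  then have F: "Poly_Mapping.keys F \<subseteq> mono_of ` Pow {1..n}"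
      "\<And>T. T \<subseteq> {1..n} \<Longrightarrow> peval (\<lambda>i. if i \<in> T then 1 else 0) F = f T"
    and G: "Poly_Mapping.keys G \<subseteq> mono_of ` Pow {1..n}"
      "\<And>T. T \<subseteq> {1..n} \<Longrightarrow> peval (\<lambda>i. if i \<in> T then 1 else 0) G = f T"
    by (simp_all add: is_mle_def keys_multilinear)
  have eq: "Poly_Mapping.lookup F (mono_of U) = Poly_Mapping.lookup G (mono_of U)"
    if "U \<subseteq> {1..n}" for U
  proof (rule moebius_unique[of "{1..n}" "\<lambda>U. Poly_Mapping.lookup F (mono_of U)"
        "\<lambda>U. Poly_Mapping.lookup G (mono_of U)" U])
    fix T :: "nat set" assume "T \<subseteq> {1..n}"
    then show "(\<Sum>U\<in>Pow T. Poly_Mapping.lookup F (mono_of U)) =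
               (\<Sum>U\<in>Pow T. Poly_Mapping.lookup G (mono_of U))"
      using peval_indicator[OF finite_atLeastAtMost F(1)] F(2)
        peval_indicator[OF finite_atLeastAtMost G(1)] G(2) by simp
  qed (use that in simp_all)
  show "F = G"
  proof (rule poly_mapping_eqI)
    fix m
    show "Poly_Mapping.lookup F m = Poly_Mapping.lookup G m"
    proof (cases "m \<in> mono_of ` Pow {1..n}")
      case True
      then show ?thesis using eq by auto
    next
      case False
      then have "m \<notin> Poly_Mapping.keys F" "m \<notin> Poly_Mapping.keys G"
        using F(1) G(1) by blast+
      then show ?thesis by (simp add: in_keys_iff)
    qed
  qed
qed

lemma is_mle_mle: "is_mle n f (mle n f)"
  unfolding mle_def by (rule theI'[OF ex1_is_mle])

end

theory Submission
  imports Defs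
begin

text \<open>
  Both ideals contain the Boolean axioms \<open>v\<^sup>2 - v\<close>, so both are vanishing ideals of finite sets
  of 0/1 points (\<open>boolean_Nullstellensatz\<close>): for \<open>I2\<close> these are all indicator vectors, for \<open>I0\<close>
  the points \<open>x = 1\<^sub>A\<close>, \<open>y = 1\<^sub>B\<close>, \<open>s = 1\<^sub>A\<^sub>\<inter>\<^sub>B\<close> for sets \<open>A\<close> and \<open>B\<close>. Being a sum of
  squares modulo the ideal thus means having the values of a sum of squares at these points
  (\<open>sos_mod_iff_sos_on\<close>), and only values of polynomials matter from then on, apart from the
  degrees of the squares. Write \<open>g A\<close> for \<open>F(1\<^sub>A)\<close>; the first and second partial derivatives of
  the multilinear \<open>F\<close> are the first and second differences of \<open>g\<close>.

  From submodularity to \<open>G1\<close>: at the point of \<open>A\<close> and \<open>B\<close>, \<open>G1\<close> compares \<open>g (A \<union> B) - g A\<close> with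
  the sum of the marginal gains at \<open>A\<close> of the elements of \<open>B - A\<close>, and \<open>g (A \<union> B) - g B\<close> with
  the sum of the marginal gains at \<open>A \<union> B\<close> of the elements of \<open>A - B\<close>. Adding the elements one by
  one in increasing order and telescoping twice turns both comparisons into sums of negated second
  differences \<open>- F\<^sub>i\<^sub>j\<close> over pairs \<open>i \<noteq> j\<close> of elements of \<open>B - A\<close>, respectively of \<open>A - B\<close>, each
  evaluated at a set such as \<open>A \<union> (B \<inter> {..<j})\<close> (\<open>peval_G1_eq_hessian_parts\<close>). The coordinates of
  this set are affine in \<open>x, y, s\<close>, so substituting them does not raise degrees, and that
  \<open>i, j\<close> lie in \<open>B - A\<close> is expressed by the factor \<open>(y\<^sub>i - s\<^sub>i) (y\<^sub>j - s\<^sub>j)\<close>. This factor takes the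
  values 0 and 1, so it may be replaced by its square and absorbed into the squares, at the cost
  of 2 degrees (\<open>sos_on_weighted_psubst\<close>).

  From \<open>G1\<close> to submodularity: on the slice \<open>A = U - {i, j}\<close>, \<open>B = U\<close> the polynomial \<open>G1\<close> is
  \<open>- x\<^sub>i x\<^sub>j F\<^sub>i\<^sub>j(x)\<close>, where \<open>x\<close> is the indicator vector of \<open>U\<close> (\<open>peval_G1_slice\<close>). If this is a sum of
  squares \<open>q\<^sup>2\<close>, then every \<open>q\<close> vanishes wherever \<open>x\<^sub>i x\<^sub>j = 0\<close>. Hence where \<open>x\<^sub>i = x\<^sub>j = 1\<close> it agrees
  with its second discrete derivative in the directions \<open>i\<close> and \<open>j\<close>, which has dropped 2 degrees
  and no longer involves \<open>x\<^sub>i, x\<^sub>j\<close>. So the second discrete derivatives of the \<open>q\<close> are the squares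
  wanted for \<open>- F\<^sub>i\<^sub>j\<close> (\<open>sos_on_hessian_of_G1\<close>).
\<close>


section \<open>Monomials, evaluation and degree\<close>

text \<open>
  The values may lie in any commutative semiring, so that evaluation at numbers (\<open>peval\<close>),
  substitution of polynomials (\<open>psubst\<close>) and the monomial itself, as a product of powers of
  \<open>Var v\<close>, are all instances.
\<close>

definition monom_eval :: "('v \<Rightarrow> 'a::comm_semiring_1) \<Rightarrow> ('v \<Rightarrow>\<^sub>0 nat) \<Rightarrow> 'a" where
  "monom_eval a m = (\<Prod>v\<in>Poly_Mapping.keys m. a v ^ Poly_Mapping.lookup m v)"

lemma monom_eval_superset:
  assumes "finite A" "Poly_Mapping.keys m \<subseteq> A"
  shows "monom_eval a m = (\<Prod>v\<in>A. a v ^ Poly_Mapping.lookup m v)"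
  unfolding monom_eval_def using assms
  by (intro prod.mono_neutral_left) (auto simp: in_keys_iff)

lemma monom_eval_zero [simp]: "monom_eval a 0 = 1"
  by (simp add: monom_eval_def)

lemma monom_eval_single [simp]: "monom_eval a (Poly_Mapping.single v k) = a v ^ k"
  by (simp add: monom_eval_def)

lemma monom_eval_add: "monom_eval a (m + m') = monom_eval a m * monom_eval a m'"
proof -
  let ?A = "Poly_Mapping.keys m \<union> Poly_Mapping.keys m'"
  have "Poly_Mapping.keys (m + m') \<subseteq> ?A" by (rule keys_add)
  then show ?thesis
    by (simp add: monom_eval_superset[of ?A] lookup_add power_add prod.distrib)
qed

lemma mdegree_superset:
  assumes "finite A" "Poly_Mapping.keys m \<subseteq> A"
  shows "mdegree m = (\<Sum>v\<in>A. Poly_Mapping.lookup m v)"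
  unfolding mdegree_def using assms
  by (intro sum.mono_neutral_left) (auto simp: in_keys_iff)

lemma mdegree_add: "mdegree (m + m') = mdegree m + mdegree m'"
proof -
  let ?A = "Poly_Mapping.keys m \<union> Poly_Mapping.keys m'"
  have "Poly_Mapping.keys (m + m') \<subseteq> ?A" by (rule keys_add)
  then show ?thesis
    by (simp add: mdegree_superset[of ?A] lookup_add sum.distrib)
qed

lemma poly_mapping_sum_singles:
  "(\<Sum>m\<in>Poly_Mapping.keys p. Poly_Mapping.single m (Poly_Mapping.lookup p m)) = p"
  by (rule poly_mapping_eqI)
     (auto simp: lookup_sum lookup_single when_def sum.delta in_keys_iff)

lemma peval_eq_monom_eval:
  "peval a p = (\<Sum>m\<in>Poly_Mapping.keys p. Poly_Mapping.lookup p m * monom_eval a m)"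
  by (simp add: peval_def monom_eval_def)

lemma psubst_eq_monom_eval:
  "psubst \<sigma> p = (\<Sum>m\<in>Poly_Mapping.keys p. Const (Poly_Mapping.lookup p m) * monom_eval \<sigma> m)"
  by (simp add: psubst_def monom_eval_def)

lemma peval_superset:
  assumes "finite A" "Poly_Mapping.keys p \<subseteq> A"
  shows "peval a p = (\<Sum>m\<in>A. Poly_Mapping.lookup p m * monom_eval a m)"
  unfolding peval_eq_monom_eval using assms
  by (intro sum.mono_neutral_left) (auto simp: in_keys_iff)

lemma peval_zero [simp]: "peval a 0 = 0"
  by (simp add: peval_def)

lemma peval_single [simp]: "peval a (Poly_Mapping.single m c) = c * monom_eval a m"
  by (simp add: peval_eq_monom_eval)

lemma peval_Const [simp]: "peval a (Const c) = c"
  by (simp add: Const_def)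

lemma peval_Var [simp]: "peval a (Var v) = a v"
  by (simp add: Var_def)

lemma Const_0 [simp]: "Const 0 = 0" and Const_1 [simp]: "Const 1 = 1"
  by (simp_all add: Const_def)

lemma peval_one [simp]: "peval a 1 = 1"
  using peval_Const[of a 1] by simp

lemma peval_add [simp]: "peval a (p + q) = peval a p + peval a q"
proof -
  let ?A = "Poly_Mapping.keys p \<union> Poly_Mapping.keys q"
  have "Poly_Mapping.keys (p + q) \<subseteq> ?A" by (rule keys_add)
  then show ?thesis
    by (simp add: peval_superset[of ?A] lookup_add algebra_simps sum.distrib)
qed

lemma peval_sum [simp]: "peval a (\<Sum>i\<in>A. p i) = (\<Sum>i\<in>A. peval a (p i))"
  by (induction A rule: infinite_finite_induct) auto

lemma peval_mult [simp]: "peval a (p * q) = peval a p * peval a q"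
proof -
  have "p * q = (\<Sum>m\<in>Poly_Mapping.keys p. Poly_Mapping.single m (Poly_Mapping.lookup p m)) *
                (\<Sum>m\<in>Poly_Mapping.keys q. Poly_Mapping.single m (Poly_Mapping.lookup q m))"
    by (simp add: poly_mapping_sum_singles)
  then show ?thesis
    by (simp add: sum_product mult_single monom_eval_add peval_eq_monom_eval[of a p]
        peval_eq_monom_eval[of a q] mult_ac)
qed

lemma peval_uminus [simp]: "peval a (- p) = - peval a p"
  using peval_add[of a p "- p"] by simp

lemma peval_diff [simp]: "peval a (p - q) = peval a p - peval a q"
  using peval_add[of a p "- q"] by simp

lemma peval_prod [simp]: "peval a (\<Prod>i\<in>A. p i) = (\<Prod>i\<in>A. peval a (p i))"
  by (induction A rule: infinite_finite_induct) auto

lemma peval_power [simp]: "peval a (p ^ k) = peval a p ^ k"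
  by (induction k) auto

lemma peval_sum_list [simp]: "peval a (\<Sum>q\<leftarrow>qs. p q) = (\<Sum>q\<leftarrow>qs. peval a (p q))"
  by (induction qs) auto

lemma peval_psubst [simp]: "peval a (psubst \<sigma> p) = peval (\<lambda>v. peval a (\<sigma> v)) p"
  by (simp add: psubst_def peval_def[of _ p])

lemma peval_cong:
  assumes "p \<in> polys V" "\<And>v. v \<in> V \<Longrightarrow> a v = b v"
  shows "peval a p = peval b p"
  unfolding peval_def
  by (intro sum.cong refl arg_cong2[where f = "(*)"] prod.cong arg_cong2[where f = "(^)"])
     (use assms in \<open>auto simp: polys_def\<close>)

definition polys_deg :: "'v set \<Rightarrow> nat \<Rightarrow> 'v mpoly set" where
  "polys_deg V d = {p \<in> polys V. total_degree p \<le> d}"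

lemma polys_deg_iff:
  "p \<in> polys_deg V d \<longleftrightarrow>
     (\<forall>m\<in>Poly_Mapping.keys p. Poly_Mapping.keys m \<subseteq> V \<and> mdegree m \<le> d)"
  by (auto simp: polys_deg_def polys_def total_degree_def)

lemma polys_degD: "p \<in> polys_deg V d \<Longrightarrow> p \<in> polys V"
  by (simp add: polys_deg_def)

lemma polys_deg_mono: "p \<in> polys_deg V d \<Longrightarrow> d \<le> e \<Longrightarrow> p \<in> polys_deg V e"
  by (simp add: polys_deg_def)

lemma polys_degI: "p \<in> polys V \<Longrightarrow> p \<in> polys_deg V (total_degree p)"
  by (simp add: polys_deg_def)

lemma polys_deg_Const: "Const c \<in> polys_deg V d"
  by (auto simp: polys_deg_iff Const_def mdegree_def)

lemma polys_deg_zero: "0 \<in> polys_deg V d"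
  using polys_deg_Const[of 0] by simp

lemma polys_deg_one: "1 \<in> polys_deg V d"
  using polys_deg_Const[of 1] by simp

lemma polys_deg_Var: "v \<in> V \<Longrightarrow> Var v \<in> polys_deg V 1"
  by (auto simp: polys_deg_iff Var_def mdegree_def)

lemma polys_deg_add: "p \<in> polys_deg V d \<Longrightarrow> q \<in> polys_deg V d \<Longrightarrow> p + q \<in> polys_deg V d"
  using keys_add[of p q] by (auto simp: polys_deg_iff)

lemma polys_deg_mult:
  assumes "p \<in> polys_deg V d" "q \<in> polys_deg V e"
  shows "p * q \<in> polys_deg V (d + e)"
proof -
  have "Poly_Mapping.keys m \<subseteq> V \<and> mdegree m \<le> d + e" if "m \<in> Poly_Mapping.keys (p * q)" for m
  proof -
    obtain m1 m2 where m: "m = m1 + m2"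
      and m1: "m1 \<in> Poly_Mapping.keys p" and m2: "m2 \<in> Poly_Mapping.keys q"
      using \<open>m \<in> Poly_Mapping.keys (p * q)\<close> keys_mult[of p q] by blast
    have "Poly_Mapping.keys m1 \<subseteq> V" "mdegree m1 \<le> d" "Poly_Mapping.keys m2 \<subseteq> V" "mdegree m2 \<le> e"
      using assms m1 m2 by (auto simp: polys_deg_iff)
    then show ?thesis
      using keys_add[of m1 m2] by (auto simp: m mdegree_add)
  qed
  then show ?thesis by (simp add: polys_deg_iff)
qed

lemma polys_deg_uminus: "p \<in> polys_deg V d \<Longrightarrow> - p \<in> polys_deg V d"
  by (simp add: polys_deg_iff)

lemma polys_deg_diff: "p \<in> polys_deg V d \<Longrightarrow> q \<in> polys_deg V d \<Longrightarrow> p - q \<in> polys_deg V d"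
  using polys_deg_add[of p V d "- q"] polys_deg_uminus[of q V d] by simp

lemma polys_deg_sum: "(\<And>i. i \<in> A \<Longrightarrow> p i \<in> polys_deg V d) \<Longrightarrow> (\<Sum>i\<in>A. p i) \<in> polys_deg V d"
  by (induction A rule: infinite_finite_induct) (auto intro: polys_deg_add polys_deg_zero)

lemma polys_deg_power: "p \<in> polys_deg V d \<Longrightarrow> p ^ k \<in> polys_deg V (k * d)"
  by (induction k) (auto intro: polys_deg_mult polys_deg_one)

lemma polys_deg_prod:
  "(\<And>i. i \<in> A \<Longrightarrow> p i \<in> polys_deg V (d i)) \<Longrightarrow> (\<Prod>i\<in>A. p i) \<in> polys_deg V (\<Sum>i\<in>A. d i)"
  by (induction A rule: infinite_finite_induct) (auto intro: polys_deg_mult polys_deg_one)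

text \<open>An affine substitution does not raise the degree.\<close>

lemma polys_deg_psubst:
  assumes p: "p \<in> polys_deg V d" and \<sigma>: "\<And>v. v \<in> V \<Longrightarrow> \<sigma> v \<in> polys_deg W 1"
  shows "psubst \<sigma> p \<in> polys_deg W d"
  unfolding psubst_eq_monom_eval
proof (rule polys_deg_sum)
  fix m assume "m \<in> Poly_Mapping.keys p"
  then have m: "Poly_Mapping.keys m \<subseteq> V" "mdegree m \<le> d"
    using p by (auto simp: polys_deg_iff)
  have "monom_eval \<sigma> m \<in> polys_deg W (\<Sum>v\<in>Poly_Mapping.keys m. Poly_Mapping.lookup m v)"
    unfolding monom_eval_def
  proof (rule polys_deg_prod)
    fix v assume "v \<in> Poly_Mapping.keys m"
    then have "\<sigma> v \<in> polys_deg W 1" using m \<sigma> by blast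
    from polys_deg_power[OF this] show "\<sigma> v ^ Poly_Mapping.lookup m v \<in> polys_deg W (Poly_Mapping.lookup m v)"
      by simp
  qed
  then have "monom_eval \<sigma> m \<in> polys_deg W d"
    using m(2) by (auto simp: mdegree_def intro: polys_deg_mono)
  from polys_deg_mult[OF polys_deg_Const[where d = 0] this]
  show "Const (Poly_Mapping.lookup p m) * monom_eval \<sigma> m \<in> polys_deg W d"
    by simp
qed

lemma polys_Const: "Const c \<in> polys V"
  by (rule polys_degD[OF polys_deg_Const])

lemma polys_zero: "0 \<in> polys V"
  by (rule polys_degD[OF polys_deg_zero])

lemma polys_one: "1 \<in> polys V"
  by (rule polys_degD[OF polys_deg_one])

lemma polys_Var: "v \<in> V \<Longrightarrow> Var v \<in> polys V"
  by (rule polys_degD[OF polys_deg_Var])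

lemma polys_add: "p \<in> polys V \<Longrightarrow> q \<in> polys V \<Longrightarrow> p + q \<in> polys V"
  using keys_add[of p q] by (auto simp: polys_def)

lemma polys_uminus: "p \<in> polys V \<Longrightarrow> - p \<in> polys V"
  by (simp add: polys_def)

lemma polys_diff: "p \<in> polys V \<Longrightarrow> q \<in> polys V \<Longrightarrow> p - q \<in> polys V"
  using polys_add[of p V "- q"] polys_uminus[of q V] by simp

lemma polys_mult: "p \<in> polys V \<Longrightarrow> q \<in> polys V \<Longrightarrow> p * q \<in> polys V"
  by (rule polys_degD[OF polys_deg_mult[OF polys_degI polys_degI]])

lemma polys_sum: "(\<And>i. i \<in> A \<Longrightarrow> p i \<in> polys V) \<Longrightarrow> (\<Sum>i\<in>A. p i) \<in> polys V"
  by (induction A rule: infinite_finite_induct) (auto intro: polys_add polys_zero)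

lemma polys_prod: "(\<And>i. i \<in> A \<Longrightarrow> p i \<in> polys V) \<Longrightarrow> (\<Prod>i\<in>A. p i) \<in> polys V"
  by (induction A rule: infinite_finite_induct) (auto intro: polys_mult polys_one)

lemma polys_power: "p \<in> polys V \<Longrightarrow> p ^ k \<in> polys V"
  by (induction k) (auto intro: polys_mult polys_one)

lemma polys_sum_list: "(\<And>q. q \<in> set qs \<Longrightarrow> p q \<in> polys V) \<Longrightarrow> (\<Sum>q\<leftarrow>qs. p q) \<in> polys V"
  by (induction qs) (auto intro: polys_add polys_zero)

lemma polys_psubst:
  assumes "p \<in> polys V" "\<And>v. v \<in> V \<Longrightarrow> \<sigma> v \<in> polys_deg W 1"
  shows "psubst \<sigma> p \<in> polys W"
  using polys_degD[OF polys_deg_psubst[OF polys_degI]] assms by blast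

lemma Var_power: "Var v ^ k = Poly_Mapping.single (Poly_Mapping.single v k) 1"
  by (induction k) (simp_all add: Var_def mult_single flip: single_add)

lemma monom_eval_Var: "monom_eval Var m = Poly_Mapping.single m 1"
proof -
  have "(\<Prod>v\<in>A. Poly_Mapping.single (g v) (1::real)) = Poly_Mapping.single (\<Sum>v\<in>A. g v) 1"
    if "finite A" for A and g :: "'a \<Rightarrow> 'a \<Rightarrow>\<^sub>0 nat"
    using that by (induction A rule: finite_induct) (simp_all add: mult_single)
  then show ?thesis
    by (simp add: monom_eval_def Var_power poly_mapping_sum_singles)
qed

text \<open>The ring of polynomials in \<open>V\<close> is generated by the constants and the variables in \<open>V\<close>.\<close>

lemma polys_induct [consumes 1, case_names Const Var add mult]:
  assumes p: "p \<in> polys V"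
    and Const: "\<And>c. P (Const c)"
    and Var: "\<And>v. v \<in> V \<Longrightarrow> P (Var v)"
    and add: "\<And>p q. p \<in> polys V \<Longrightarrow> q \<in> polys V \<Longrightarrow> P p \<Longrightarrow> P q \<Longrightarrow> P (p + q)"
    and mult: "\<And>p q. p \<in> polys V \<Longrightarrow> q \<in> polys V \<Longrightarrow> P p \<Longrightarrow> P q \<Longrightarrow> P (p * q)"
  shows "P p"
proof -
  define Q where "Q p \<longleftrightarrow> p \<in> polys V \<and> P p" for p
  have Q_Const: "Q (Const c)" for c
    using Const by (simp add: Q_def polys_Const)
  have Q_mult: "Q (p * q)" if "Q p" "Q q" for p q
    using that mult by (simp add: Q_def polys_mult)
  have Q_sum: "Q (\<Sum>i\<in>A. g i)" if "finite A" "\<And>i. i \<in> A \<Longrightarrow> Q (g i)"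
    for A and g :: "('a \<Rightarrow>\<^sub>0 nat) \<Rightarrow> _"
    using that
  proof (induction A rule: finite_induct)
    case empty
    show ?case using Q_Const[of 0] by simp
  next
    case (insert i A)
    then show ?case using add by (simp add: Q_def polys_add)
  qed
  have Q_power: "Q (Var v ^ k)" if "v \<in> V" for v k
  proof (induction k)
    case 0
    show ?case using Q_Const[of 1] by simp
  next
    case (Suc k)
    have "Q (Var v)" using that Var by (simp add: Q_def polys_Var)
    then show ?case using Q_mult Suc by simp
  qed
  have Q_prod: "Q (\<Prod>v\<in>A. g v)" if "finite A" "\<And>v. v \<in> A \<Longrightarrow> Q (g v)" for A and g :: "'a \<Rightarrow> _"
    using that
  proof (induction A rule: finite_induct)
    case empty
    show ?case using Q_Const[of 1] by simp
  next
    case (insert i A)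
    then show ?case using Q_mult by simp
  qed
  have "Q (Const (Poly_Mapping.lookup p m) * monom_eval Var m)" if "m \<in> Poly_Mapping.keys p" for m
  proof -
    have "Poly_Mapping.keys m \<subseteq> V" using that p by (auto simp: polys_def)
    then have "Q (monom_eval Var m)"
      unfolding monom_eval_def by (intro Q_prod Q_power) auto
    then show ?thesis by (intro Q_mult Q_Const)
  qed
  then have "Q (\<Sum>m\<in>Poly_Mapping.keys p. Const (Poly_Mapping.lookup p m) * monom_eval Var m)"
    by (intro Q_sum) auto
  then have "Q (\<Sum>m\<in>Poly_Mapping.keys p. Poly_Mapping.single m (Poly_Mapping.lookup p m))"
    by (simp add: monom_eval_Var Const_def mult_single)
  then show ?thesis
    by (simp add: poly_mapping_sum_singles Q_def)
qed


section \<open>A Nullstellensatz for ideals containing the Boolean axioms\<close>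

lemma ideal_of_add:
  assumes "p \<in> ideal_of V B" "q \<in> ideal_of V B"
  shows "p + q \<in> ideal_of V B"
proof -
  obtain A1 h1 where 1: "p = (\<Sum>b\<in>A1. h1 b * b)" "finite A1" "A1 \<subseteq> B" "\<forall>b\<in>A1. h1 b \<in> polys V"
    using assms(1) by (auto simp: ideal_of_def)
  obtain A2 h2 where 2: "q = (\<Sum>b\<in>A2. h2 b * b)" "finite A2" "A2 \<subseteq> B" "\<forall>b\<in>A2. h2 b \<in> polys V"
    using assms(2) by (auto simp: ideal_of_def)
  define h where "h b = (if b \<in> A1 then h1 b else 0) + (if b \<in> A2 then h2 b else 0)" for b
  have "p = (\<Sum>b\<in>A1 \<union> A2. (if b \<in> A1 then h1 b else 0) * b)"
    unfolding 1(1) using 1 2 by (intro sum.mono_neutral_cong_left) auto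
  moreover have "q = (\<Sum>b\<in>A1 \<union> A2. (if b \<in> A2 then h2 b else 0) * b)"
    unfolding 2(1) using 1 2 by (intro sum.mono_neutral_cong_left) auto
  ultimately have "p + q = (\<Sum>b\<in>A1 \<union> A2. h b * b)"
    by (simp add: h_def distrib_right sum.distrib)
  moreover have "\<forall>b\<in>A1 \<union> A2. h b \<in> polys V"
    using 1 2 by (auto simp: h_def intro: polys_add polys_zero)
  ultimately show ?thesis
    unfolding ideal_of_def using 1 2 by blast
qed

lemma ideal_of_mult:
  assumes "p \<in> ideal_of V B" "r \<in> polys V"
  shows "r * p \<in> ideal_of V B"
proof -
  obtain A h where 1: "p = (\<Sum>b\<in>A. h b * b)" "finite A" "A \<subseteq> B" "\<forall>b\<in>A. h b \<in> polys V"
    using assms(1) by (auto simp: ideal_of_def)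
  have "r * p = (\<Sum>b\<in>A. (r * h b) * b)"
    by (simp add: 1 sum_distrib_left mult.assoc)
  moreover have "\<forall>b\<in>A. r * h b \<in> polys V"
    using 1 assms by (auto intro: polys_mult)
  ultimately show ?thesis
    unfolding ideal_of_def using 1(2,3)
    by (intro CollectI exI[of _ A] exI[of _ "\<lambda>b. r * h b"]) simp
qed

lemma ideal_of_generator:
  assumes "b \<in> B"
  shows "b \<in> ideal_of V B"
  unfolding ideal_of_def
  by (rule CollectI, rule exI[of _ "{b}"], rule exI[of _ "\<lambda>_. 1"])
     (use assms in \<open>auto intro: polys_one\<close>)

lemma ideal_of_zero: "0 \<in> ideal_of V B"
  unfolding ideal_of_def by (rule CollectI, rule exI[of _ "{}"]) auto

lemma ideal_of_sum:
  "(\<And>i. i \<in> A \<Longrightarrow> p i \<in> ideal_of V B) \<Longrightarrow> (\<Sum>i\<in>A. p i) \<in> ideal_of V B"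
  by (induction A rule: infinite_finite_induct) (auto intro: ideal_of_add ideal_of_zero)

lemma ideal_of_vanishes:
  assumes "p \<in> ideal_of V B" "\<And>b. b \<in> B \<Longrightarrow> peval a b = 0"
  shows "peval a p = 0"
proof -
  obtain A h where "p = (\<Sum>b\<in>A. h b * b)" "A \<subseteq> B"
    using assms(1) by (auto simp: ideal_of_def)
  then show ?thesis using assms(2) by (auto intro!: sum.neutral)
qed

definition indicator_point :: "'v set \<Rightarrow> 'v \<Rightarrow> real" where
  "indicator_point U v = of_bool (v \<in> U)"

text \<open>
  The Lagrange polynomial of the point \<open>indicator_point U\<close>: it is 1 there and 0 at the indicator
  vectors of all other subsets of \<open>V\<close>.
\<close>

definition point_poly :: "'v set \<Rightarrow> 'v set \<Rightarrow> 'v mpoly" where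
  "point_poly V U = (\<Prod>v\<in>U. Var v) * (\<Prod>v\<in>V - U. 1 - Var v)"

lemma polys_point_poly: "U \<subseteq> V \<Longrightarrow> point_poly V U \<in> polys V"
  unfolding point_poly_def
  by (intro polys_mult polys_prod polys_diff polys_Var polys_one) auto

text \<open>Expand the product of the factors \<open>Var v + (1 - Var v) = 1\<close>.\<close>

lemma sum_point_poly:
  assumes "finite V"
  shows "(\<Sum>U\<in>Pow V. point_poly V U) = 1"
  using prod_add[OF assms, of Var "\<lambda>v. 1 - Var v"] by (simp add: point_poly_def)

text \<open>
  The polynomial \<open>point_poly V U\<close> is an eigenvector of multiplication by every variable modulo
  the Boolean axioms, hence of multiplication by every \<open>p\<close>: the eigenvalue is the value of \<open>p\<close>
  at the point.
\<close>

lemma mult_point_poly: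
  assumes V: "finite V" and bool: "\<And>v. v \<in> V \<Longrightarrow> (Var v)\<^sup>2 - Var v \<in> B"
    and U: "U \<subseteq> V" and p: "p \<in> polys V"
  shows "p * point_poly V U - Const (peval (indicator_point U) p) * point_poly V U \<in> ideal_of V B"
  using p
proof (induction p rule: polys_induct)
  case (Const c)
  show ?case by (simp add: ideal_of_zero)
next
  case (Var v)
  have fin: "finite U" "finite (V - U)" using U V finite_subset by auto
  have gen: "r * ((Var v)\<^sup>2 - Var v) \<in> ideal_of V B" if "r \<in> polys V" for r
    using that Var by (intro ideal_of_mult ideal_of_generator bool)
  show ?case
  proof (cases "v \<in> U")
    case True
    define r where "r = (\<Prod>w\<in>U - {v}. Var w) * (\<Prod>w\<in>V - U. 1 - Var w)"
    have "point_poly V U = Var v * r"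
      using prod.remove[OF fin(1) True, of Var]
      by (simp add: point_poly_def r_def mult.assoc)
    then have "Var v * point_poly V U - Const (peval (indicator_point U) (Var v)) * point_poly V U
                 = r * ((Var v)\<^sup>2 - Var v)"
      using True by (simp add: indicator_point_def algebra_simps power2_eq_square)
    moreover have "r \<in> polys V"
      unfolding r_def using U
      by (intro polys_mult polys_prod polys_diff polys_Var polys_one) auto
    ultimately show ?thesis using gen by simp
  next
    case False
    define r where "r = - ((\<Prod>w\<in>U. Var w) * (\<Prod>w\<in>V - U - {v}. 1 - Var w))"
    have "(\<Prod>w\<in>V - U. 1 - Var w) = (1 - Var v) * (\<Prod>w\<in>V - U - {v}. 1 - Var w :: 'a mpoly)"
      using Var False by (intro prod.remove fin) auto
    then have e: "point_poly V U = (Var v - 1) * r"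
      unfolding point_poly_def r_def by (simp only:) (simp add: algebra_simps)
    have "Var v * point_poly V U - Const (peval (indicator_point U) (Var v)) * point_poly V U
                 = r * ((Var v)\<^sup>2 - Var v)"
      using False by (simp add: e indicator_point_def algebra_simps power2_eq_square)
    moreover have "r \<in> polys V"
      unfolding r_def using U
      by (intro polys_uminus polys_mult polys_prod polys_diff polys_Var polys_one) auto
    ultimately show ?thesis using gen by simp
  qed
next
  case (add p q)
  have "Const (c + d) = Const c + (Const d :: 'a mpoly)" for c d
    by (simp add: Const_def single_add)
  then show ?case
    using ideal_of_add[OF add.IH] by (simp add: algebra_simps)
next
  case (mult p q)
  let ?e = "point_poly V U" and ?c = "\<lambda>p. Const (peval (indicator_point U) p) :: 'a mpoly"
  have "Const (c * d) = Const c * (Const d :: 'a mpoly)" for c d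
    by (simp add: Const_def mult_single)
  then have "p * q * ?e - ?c (p * q) * ?e = p * (q * ?e - ?c q * ?e) + ?c q * (p * ?e - ?c p * ?e)"
    by (simp add: algebra_simps)
  then show ?case
    using mult by (auto intro!: ideal_of_add ideal_of_mult polys_Const)
qed

text \<open>
  Since the \<open>point_poly V U\<close> add up to 1, every \<open>p\<close> is congruent to the interpolation sum of
  its values times the \<open>point_poly V U\<close>. Where some generator \<open>b\<close> does not vanish,
  \<open>point_poly V U\<close> itself lies in the ideal, being congruent to a nonzero multiple of
  \<open>b * point_poly V U\<close>.
\<close>

lemma boolean_Nullstellensatz:
  assumes V: "finite V" and B: "B \<subseteq> polys V" and bool: "\<And>v. v \<in> V \<Longrightarrow> (Var v)\<^sup>2 - Var v \<in> B"
    and p: "p \<in> polys V"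
    and zero: "\<And>U. U \<subseteq> V \<Longrightarrow> (\<And>b. b \<in> B \<Longrightarrow> peval (indicator_point U) b = 0) \<Longrightarrow>
                 peval (indicator_point U) p = 0"
  shows "p \<in> ideal_of V B"
proof -
  have "p * point_poly V U \<in> ideal_of V B" if U: "U \<subseteq> V" for U
  proof (cases "\<forall>b\<in>B. peval (indicator_point U) b = 0")
    case True
    then show ?thesis using mult_point_poly[OF V bool U p] zero U by simp
  next
    case False
    then obtain b where b: "b \<in> B" "peval (indicator_point U) b \<noteq> 0" by blast
    let ?c = "peval (indicator_point U) b" and ?e = "point_poly V U"
    have "?e * b + Const (-1) * (b * ?e - Const ?c * ?e) \<in> ideal_of V B"
      using b B U V bool
      by (intro ideal_of_add ideal_of_mult ideal_of_generator mult_point_poly polys_Const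
          polys_point_poly) auto
    moreover have "Const (-1) = - (1 :: 'a mpoly)"
      by (simp add: Const_def single_uminus)
    ultimately have "Const ?c * ?e \<in> ideal_of V B"
      by (simp add: algebra_simps)
    then have "(p * Const (inverse ?c)) * (Const ?c * ?e) \<in> ideal_of V B"
      by (rule ideal_of_mult) (intro polys_mult polys_Const p)
    moreover have inv: "Const (inverse ?c) * Const ?c = (1 :: 'a mpoly)"
      using b(2) by (simp add: Const_def mult_single)
    have "(p * Const (inverse ?c)) * (Const ?c * ?e) = p * (Const (inverse ?c) * Const ?c) * ?e"
      by (simp only: mult.assoc)
    then have "(p * Const (inverse ?c)) * (Const ?c * ?e) = p * ?e"
      by (simp only: inv mult_1_right)
    ultimately show ?thesis by simp
  qed
  then have "(\<Sum>U\<in>Pow V. p * point_poly V U) \<in> ideal_of V B"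
    by (intro ideal_of_sum) auto
  then show ?thesis
    by (simp add: sum_point_poly[OF V] flip: sum_distrib_left)
qed

lemma I2_iff:
  assumes V: "finite V" and p: "p \<in> polys V"
  shows "p \<in> I2 V \<longleftrightarrow> (\<forall>a\<in>indicator_point ` Pow V. peval a p = 0)"
proof
  assume "p \<in> I2 V"
  then show "\<forall>a\<in>indicator_point ` Pow V. peval a p = 0"
    unfolding I2_def by (auto elim!: ideal_of_vanishes simp: indicator_point_def)
next
  assume "\<forall>a\<in>indicator_point ` Pow V. peval a p = 0"
  then show "p \<in> I2 V"
    unfolding I2_def
    by (intro boolean_Nullstellensatz V p) (auto intro!: polys_diff polys_power polys_Var)
qed

fun xys_point :: "nat set \<Rightarrow> nat set \<Rightarrow> xys \<Rightarrow> real" where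
  "xys_point A B (xys.X i) = of_bool (i \<in> A)"
| "xys_point A B (xys.Y i) = of_bool (i \<in> B)"
| "xys_point A B (xys.S i) = of_bool (i \<in> A \<inter> B)"

definition xys_points :: "nat \<Rightarrow> (xys \<Rightarrow> real) set" where
  "xys_points n = {xys_point A B | A B. A \<subseteq> {1..n} \<and> B \<subseteq> {1..n}}"

lemma xys_vars_simps [simp]:
  "xys.X i \<in> xys_vars n \<longleftrightarrow> i \<in> {1..n}"
  "xys.Y i \<in> xys_vars n \<longleftrightarrow> i \<in> {1..n}"
  "xys.S i \<in> xys_vars n \<longleftrightarrow> i \<in> {1..n}"
  by (auto simp: xys_vars_def)

text \<open>
  At a 0/1 point where the generator \<open>x\<^sub>i y\<^sub>i - s\<^sub>i\<close> vanishes, \<open>s\<close> is determined by \<open>x\<close> and \<open>y\<close>, so the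
  point is some \<open>xys_point A B\<close>; at these, the other generators vanish as well.
\<close>

lemma I0_iff:
  assumes p: "p \<in> polys (xys_vars n)"
  shows "p \<in> I0 n \<longleftrightarrow> (\<forall>a\<in>xys_points n. peval a p = 0)"
proof
  assume "p \<in> I0 n"
  then show "\<forall>a\<in>xys_points n. peval a p = 0"
    unfolding I0_def by (auto elim!: ideal_of_vanishes simp: xys_points_def)
next
  assume zero: "\<forall>a\<in>xys_points n. peval a p = 0"
  show "p \<in> I0 n"
    unfolding I0_def
  proof (rule boolean_Nullstellensatz[OF _ _ _ p], goal_cases)
    case 1
    show ?case by (simp add: xys_vars_def)
  next
    case 2
    show ?case by (auto intro!: polys_diff polys_power polys_mult polys_Var)
  next
    case (3 v)
    then show ?case by (cases v) auto
  next
    case (4 U)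
    define A where "A = {i. xys.X i \<in> U}"
    define B where "B = {i. xys.Y i \<in> U}"
    have AB: "A \<subseteq> {1..n}" "B \<subseteq> {1..n}"
      using subsetD[OF 4(1), of "xys.X _"] subsetD[OF 4(1), of "xys.Y _"]
      unfolding A_def B_def xys_vars_simps by blast+
    have S: "xys.S i \<in> U \<longleftrightarrow> i \<in> A \<inter> B" if "i \<in> {1..n}" for i
    proof -
      have "Var (xys.X i) * Var (xys.Y i) - Var (xys.S i) \<in> (\<Union>i\<in>{1..n}. {(Defs.x i)\<^sup>2 - Defs.x i,
          Defs.x i * Defs.y i - Defs.s i, Defs.x i * Defs.s i - Defs.s i,
          (Defs.y i)\<^sup>2 - Defs.y i, Defs.y i * Defs.s i - Defs.s i, (Defs.s i)\<^sup>2 - Defs.s i})"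
        using that by blast
      from 4(2)[OF this] show ?thesis
        by (auto simp: indicator_point_def A_def B_def of_bool_def split: if_splits)
    qed
    have "indicator_point U v = xys_point A B v" if "v \<in> xys_vars n" for v
      using that S by (cases v) (auto simp: indicator_point_def A_def B_def)
    then have "peval (indicator_point U) p = peval (xys_point A B) p"
      by (intro peval_cong[OF p])
    also have "\<dots> = 0"
      using zero AB by (auto simp: xys_points_def)
    finally show ?case .
  qed
qed


section \<open>Sums of squares on a set of points\<close>

definition sos_on :: "nat \<Rightarrow> 'v set \<Rightarrow> ('v \<Rightarrow> real) set \<Rightarrow> 'v mpoly \<Rightarrow> bool" where
  "sos_on t V Z p \<longleftrightarrow>
     (\<exists>qs. set qs \<subseteq> polys_deg V t \<and> (\<forall>a\<in>Z. peval a p = (\<Sum>q\<leftarrow>qs. (peval a q)\<^sup>2)))"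

lemma sos_mod_iff_sos_on:
  assumes "p \<in> polys V" "\<And>q. q \<in> polys V \<Longrightarrow> q \<in> I \<longleftrightarrow> (\<forall>a\<in>Z. peval a q = 0)"
  shows "sos_mod t V I p \<longleftrightarrow> sos_on t V Z p"
proof -
  have "p - (\<Sum>q\<leftarrow>qs. q\<^sup>2) \<in> I \<longleftrightarrow> (\<forall>a\<in>Z. peval a p = (\<Sum>q\<leftarrow>qs. (peval a q)\<^sup>2))"
    if "set qs \<subseteq> polys_deg V t" for qs
  proof -
    have "p - (\<Sum>q\<leftarrow>qs. q\<^sup>2) \<in> polys V"
      using that assms(1)
      by (intro polys_diff polys_sum_list polys_power) (auto dest: polys_degD)
    then show ?thesis by (simp add: assms(2))
  qed
  then show ?thesis
    unfolding sos_mod_def sos_on_def by (fastforce simp: polys_deg_def subset_iff)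
qed

lemma sos_on_zero: "sos_on t V Z 0"
  unfolding sos_on_def by (rule exI[of _ "[]"]) simp

lemma sos_on_add:
  assumes "sos_on t V Z p" "sos_on t V Z q"
  shows "sos_on t V Z (p + q)"
proof -
  obtain ps qs where "set ps \<subseteq> polys_deg V t" "\<forall>a\<in>Z. peval a p = (\<Sum>q\<leftarrow>ps. (peval a q)\<^sup>2)"
    "set qs \<subseteq> polys_deg V t" "\<forall>a\<in>Z. peval a q = (\<Sum>q\<leftarrow>qs. (peval a q)\<^sup>2)"
    using assms unfolding sos_on_def by blast
  then show ?thesis
    unfolding sos_on_def by (intro exI[of _ "ps @ qs"]) simp
qed

lemma sos_on_sum: "(\<And>i. i \<in> A \<Longrightarrow> sos_on t V Z (p i)) \<Longrightarrow> sos_on t V Z (\<Sum>i\<in>A. p i)"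
  by (induction A rule: infinite_finite_induct) (auto intro: sos_on_add sos_on_zero)

lemma sos_on_cong:
  "(\<And>a. a \<in> Z \<Longrightarrow> peval a p = peval a q) \<Longrightarrow> sos_on t V Z p \<longleftrightarrow> sos_on t V Z q"
  by (simp add: sos_on_def)

text \<open>
  The hypothesis on \<open>h\<close> speaks of 0/1 points only, so \<open>\<sigma>\<close> has to map the points of \<open>Z\<close> to such
  points. Every square \<open>q\<^sup>2\<close> for \<open>h\<close> then yields the square of \<open>w * psubst \<sigma> q\<close>.
\<close>

lemma sos_on_weighted_psubst:
  assumes h: "sos_on t W (indicator_point ` Pow W) h" "h \<in> polys W"
    and w: "w \<in> polys_deg V 2"
    and \<sigma>: "\<And>k. k \<in> W \<Longrightarrow> \<sigma> k \<in> polys_deg V 1"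
    and bool: "\<And>a k. a \<in> Z \<Longrightarrow> k \<in> W \<Longrightarrow> peval a (\<sigma> k) \<in> {0, 1}"
  shows "sos_on (t + 2) V Z (w\<^sup>2 * psubst \<sigma> h)"
proof -
  obtain qs where qs: "set qs \<subseteq> polys_deg W t"
    and h_eq: "\<And>U. U \<subseteq> W \<Longrightarrow>
      peval (indicator_point U) h = (\<Sum>q\<leftarrow>qs. (peval (indicator_point U) q)\<^sup>2)"
    using h(1) unfolding sos_on_def by blast
  have "set (map (\<lambda>q. w * psubst \<sigma> q) qs) \<subseteq> polys_deg V (t + 2)"
  proof clarsimp
    fix q assume "q \<in> set qs"
    then have "psubst \<sigma> q \<in> polys_deg V t"
      using qs \<sigma> by (intro polys_deg_psubst[of q W]) auto
    from polys_deg_mult[OF w this] show "w * psubst \<sigma> q \<in> polys_deg V (Suc (Suc t))"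
      by simp
  qed
  moreover have "peval a (w\<^sup>2 * psubst \<sigma> h) =
      (\<Sum>q\<leftarrow>map (\<lambda>q. w * psubst \<sigma> q) qs. (peval a q)\<^sup>2)" if a: "a \<in> Z" for a
  proof -
    \<comment> \<open>The point to which \<open>\<sigma>\<close> maps \<open>a\<close>, as a set.\<close>
    define U where "U = {k \<in> W. peval a (\<sigma> k) = 1}"
    have "peval a (psubst \<sigma> q) = peval (indicator_point U) q" if "q \<in> polys W" for q
      unfolding peval_psubst using bool[OF a]
      by (intro peval_cong[OF that]) (auto simp: indicator_point_def U_def)
    then have *: "peval a (psubst \<sigma> q) = peval (indicator_point U) q" if "q = h \<or> q \<in> set qs" for q
      using that qs h(2) by (auto dest: polys_degD)
    have "peval a (w\<^sup>2 * psubst \<sigma> h) = (\<Sum>q\<leftarrow>qs. (peval a w)\<^sup>2 * (peval (indicator_point U) q)\<^sup>2)"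
      using *[of h] h_eq[of U] by (simp add: U_def sum_list_const_mult del: peval_psubst)
    also have "\<dots> = (\<Sum>q\<leftarrow>qs. (peval a (w * psubst \<sigma> q))\<^sup>2)"
      by (intro arg_cong[where f = sum_list] map_cong refl)
         (use * in \<open>simp add: power_mult_distrib del: peval_psubst\<close>)
    finally show ?thesis by (simp add: comp_def)
  qed
  ultimately show ?thesis
    unfolding sos_on_def by blast
qed


section \<open>Discrete derivatives\<close>

text \<open>
  The difference quotient between \<open>v = 1\<close> and \<open>v = 0\<close>, see \<open>peval_discrete_deriv\<close>. As a difference
  of two substitutions it would not visibly have lower degree; here each monomial that contains
  \<open>v\<close> loses its whole power of \<open>v\<close>, because \<open>1 ^ k - 0 ^ k = 1\<close> for positive \<open>k\<close>, and the
  other monomials cancel.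
\<close>

definition discrete_deriv :: "'v \<Rightarrow> 'v mpoly \<Rightarrow> 'v mpoly" where
  "discrete_deriv v p = (\<Sum>m\<in>{m \<in> Poly_Mapping.keys p. v \<in> Poly_Mapping.keys m}.
     Poly_Mapping.single (m - Poly_Mapping.single v (Poly_Mapping.lookup m v)) (Poly_Mapping.lookup p m))"

lemma lookup_strip:
  fixes m :: "'v \<Rightarrow>\<^sub>0 nat"
  shows "Poly_Mapping.lookup (m - Poly_Mapping.single v (Poly_Mapping.lookup m v)) w =
    (if w = v then 0 else Poly_Mapping.lookup m w)"
  by (simp add: minus_poly_mapping.rep_eq lookup_single when_def)

lemma keys_strip:
  fixes m :: "'v \<Rightarrow>\<^sub>0 nat"
  shows "Poly_Mapping.keys (m - Poly_Mapping.single v (Poly_Mapping.lookup m v)) =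
    Poly_Mapping.keys m - {v}"
  by (auto simp: in_keys_iff lookup_strip split: if_splits)

lemma strip_add:
  fixes m :: "'v \<Rightarrow>\<^sub>0 nat"
  shows "m = (m - Poly_Mapping.single v (Poly_Mapping.lookup m v)) +
    Poly_Mapping.single v (Poly_Mapping.lookup m v)"
  by (rule poly_mapping_eqI) (simp add: lookup_add lookup_strip lookup_single when_def)

lemma peval_discrete_deriv:
  "peval a (discrete_deriv v p) = peval (a(v := 1)) p - peval (a(v := 0)) p"
proof -
  let ?strip = "\<lambda>m. m - Poly_Mapping.single v (Poly_Mapping.lookup m v)"
  have upd: "monom_eval (a(v := c)) m = monom_eval a (?strip m) * c ^ Poly_Mapping.lookup m v" for c m
  proof -
    have "monom_eval (a(v := c)) (?strip m) = monom_eval a (?strip m)"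
      unfolding monom_eval_def by (intro prod.cong refl) (auto simp: keys_strip)
    then show ?thesis
      by (subst strip_add[of m v]) (simp add: monom_eval_add)
  qed
  have "peval (a(v := 1)) p - peval (a(v := 0)) p =
    (\<Sum>m\<in>Poly_Mapping.keys p. Poly_Mapping.lookup p m *
       (monom_eval a (?strip m) * (1 - 0 ^ Poly_Mapping.lookup m v)))"
    unfolding peval_eq_monom_eval sum_subtractf[symmetric] upd
    by (intro sum.cong refl) (simp add: algebra_simps)
  also have "\<dots> = (\<Sum>m\<in>{m \<in> Poly_Mapping.keys p. v \<in> Poly_Mapping.keys m}.
       Poly_Mapping.lookup p m * monom_eval a (?strip m))"
    by (intro sum.mono_neutral_cong_right) (auto simp: in_keys_iff power_0_left)
  finally show ?thesis by (simp add: discrete_deriv_def)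
qed

lemma keys_discrete_deriv:
  assumes "m' \<in> Poly_Mapping.keys (discrete_deriv v p)"
  obtains m where "m \<in> Poly_Mapping.keys p" "v \<in> Poly_Mapping.keys m"
    "m' = m - Poly_Mapping.single v (Poly_Mapping.lookup m v)"
  using assms keys_sum unfolding discrete_deriv_def by (fastforce split: if_splits)

text \<open>Every surviving monomial contained \<open>v\<close>, and has lost it.\<close>

lemma polys_deg_discrete_deriv:
  assumes p: "p \<in> polys_deg V (Suc d)"
  shows "discrete_deriv v p \<in> polys_deg (V - {v}) d"
  unfolding polys_deg_iff
proof
  fix m' assume "m' \<in> Poly_Mapping.keys (discrete_deriv v p)"
  then obtain m where m: "m \<in> Poly_Mapping.keys p" "v \<in> Poly_Mapping.keys m"
    and m': "m' = m - Poly_Mapping.single v (Poly_Mapping.lookup m v)"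
    by (rule keys_discrete_deriv)
  have "mdegree m = mdegree m' + mdegree (Poly_Mapping.single v (Poly_Mapping.lookup m v))"
    unfolding m' mdegree_add[symmetric] by (simp flip: strip_add)
  moreover have "mdegree (Poly_Mapping.single v (Poly_Mapping.lookup m v)) > 0"
    using m(2) by (auto simp: mdegree_def in_keys_iff)
  ultimately show "Poly_Mapping.keys m' \<subseteq> V - {v} \<and> mdegree m' \<le> d"
    using p m by (auto simp: polys_deg_iff m' keys_strip)
qed

lemma polys_discrete_deriv:
  assumes "p \<in> polys V"
  shows "discrete_deriv v p \<in> polys (V - {v})"
proof -
  have "p \<in> polys_deg V (Suc (total_degree p))"
    using assms by (simp add: polys_deg_def)
  then show ?thesis by (rule polys_degD[OF polys_deg_discrete_deriv])
qed

lemma multilinear_discrete_deriv: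
  assumes "multilinear p"
  shows "multilinear (discrete_deriv v p)"
  unfolding multilinear_def
  using assms by (auto simp: multilinear_def lookup_strip elim!: keys_discrete_deriv)

text \<open>In direction \<open>v\<close> a multilinear polynomial is affine, so its slope is its difference quotient.\<close>

lemma pdiff_multilinear:
  assumes "multilinear p"
  shows "pdiff v p = discrete_deriv v p"
  unfolding pdiff_def discrete_deriv_def
proof (intro sum.mono_neutral_cong_right, goal_cases)
  case (4 m)
  then have "Poly_Mapping.lookup m v \<le> 1" "Poly_Mapping.lookup m v \<noteq> 0"
    using assms unfolding multilinear_def by (auto simp: in_keys_iff simp del: One_nat_def)
  then have "Poly_Mapping.lookup m v = 1" by simp
  then show ?case by simp
qed (auto simp: in_keys_iff intro!: gr0I)


section \<open>Marginals of set functions\<close>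

text \<open>
  Subtracting \<open>g (A - {i})\<close> rather than \<open>g A\<close> makes the marginal independent of whether \<open>i\<close> lies
  in \<open>A\<close>, as a partial derivative of a multilinear polynomial is independent of its variable.
\<close>

definition marginal :: "(nat set \<Rightarrow> real) \<Rightarrow> nat \<Rightarrow> nat set \<Rightarrow> real" where
  "marginal g i A = g (insert i A) - g (A - {i})"

lemma peval_indicator_discrete_deriv:
  "peval (indicator_point A) (discrete_deriv i p) = marginal (\<lambda>U. peval (indicator_point U) p) i A"
proof -
  have "(indicator_point A)(i := 1) = indicator_point (insert i A)"
    "(indicator_point A)(i := 0) = indicator_point (A - {i})"
    by (auto simp: indicator_point_def)
  then show ?thesis
    by (simp add: peval_discrete_deriv marginal_def)
qed

text \<open>Add the elements of \<open>T\<close> to \<open>A\<close> in increasing order.\<close>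

lemma sum_marginal_telescope:
  assumes "finite T" "T \<inter> A = {}"
  shows "(\<Sum>j\<in>T. marginal h j (A \<union> (T \<inter> {..<j}))) = h (A \<union> T) - h A"
  using assms
proof (induction T rule: finite_linorder_max_induct)
  case empty
  then show ?case by simp
next
  case (insert b T)
  then have b: "b \<notin> T" "b \<notin> A" by auto
  have "insert b T \<inter> {..<b} = T" using insert.hyps by auto
  moreover have "insert b T \<inter> {..<j} = T \<inter> {..<j}" if "j \<in> T" for j
    using insert.hyps that by force
  ultimately have "(\<Sum>j\<in>insert b T. marginal h j (A \<union> (insert b T \<inter> {..<j}))) =
      marginal h b (A \<union> T) + (\<Sum>j\<in>T. marginal h j (A \<union> (T \<inter> {..<j})))"
    using insert.hyps b by simp
  moreover have "marginal h b (A \<union> T) = h (A \<union> insert b T) - h (A \<union> T)"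
    using b by (simp add: marginal_def)
  ultimately show ?case using insert by simp
qed

text \<open>
  By telescoping, \<open>g (A \<union> T) - g A\<close> is the sum of the marginals of the \<open>i \<in> T\<close> at
  \<open>A \<union> (T \<inter> {..<i})\<close>. Comparing these with the marginals at \<open>A\<close> is again a telescoping sum, for
  the set function \<open>marginal g i\<close> and the elements of \<open>T\<close> below \<open>i\<close>.
\<close>

lemma sum_marginal_minus_increment:
  assumes "finite T" "T \<inter> A = {}"
  shows "(\<Sum>i\<in>T. marginal g i A) - (g (A \<union> T) - g A) =
    (\<Sum>i\<in>T. \<Sum>j\<in>T \<inter> {..<i}. - marginal (marginal g i) j (A \<union> (T \<inter> {..<j})))"
proof -
  have "(\<Sum>j\<in>T \<inter> {..<i}. marginal (marginal g i) j (A \<union> (T \<inter> {..<j}))) =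
      marginal g i (A \<union> (T \<inter> {..<i})) - marginal g i A" for i
  proof -
    have "T \<inter> {..<i} \<inter> {..<j} = T \<inter> {..<j}" if "j < i" for j
      using that by auto
    then show ?thesis
      using sum_marginal_telescope[of "T \<inter> {..<i}" A "marginal g i"] assms by auto
  qed
  then show ?thesis
    using sum_marginal_telescope[OF assms, of g] by (simp add: sum_negf sum_subtractf)
qed

text \<open>
  The counterpart with marginals taken at the top set \<open>B \<union> T\<close>: the second telescoping sum now
  runs over the elements of \<open>T\<close> above \<open>i\<close>.
\<close>

lemma increment_minus_sum_marginal:
  assumes "finite T" "T \<inter> B = {}"
  shows "(g (B \<union> T) - g B) - (\<Sum>i\<in>T. marginal g i (B \<union> T)) =
    (\<Sum>i\<in>T. \<Sum>j\<in>T \<inter> {i<..}. - marginal (marginal g i) j (B \<union> (T \<inter> {..<j})))"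
proof -
  have "(\<Sum>j\<in>T \<inter> {i<..}. marginal (marginal g i) j (B \<union> (T \<inter> {..<j}))) =
      marginal g i (B \<union> T) - marginal g i (B \<union> (T \<inter> {..<i}))" for i
  proof -
    have diag: "marginal (marginal g i) i C = 0" for C
      by (simp add: marginal_def)
    have "(\<Sum>j\<in>T \<inter> {i<..}. marginal (marginal g i) j (B \<union> (T \<inter> {..<j}))) =
        (\<Sum>j\<in>T \<inter> {i..}. marginal (marginal g i) j (B \<union> (T \<inter> {..<j})))"
      \<comment> \<open>Telescoping from \<open>B \<union> (T \<inter> {..<i})\<close> up to \<open>B \<union> T\<close> adds \<open>i\<close> too,
          which does not change \<open>marginal g i\<close>.\<close>
      using assms(1) diag
      by (intro sum.mono_neutral_left) (auto simp: order.order_iff_strict)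
    also have "\<dots> = (\<Sum>j\<in>T \<inter> {i..}.
        marginal (marginal g i) j ((B \<union> (T \<inter> {..<i})) \<union> (T \<inter> {i..} \<inter> {..<j})))"
      by (intro sum.cong refl arg_cong[where f = "marginal _ _"]) auto
    also have "\<dots> = marginal g i ((B \<union> (T \<inter> {..<i})) \<union> (T \<inter> {i..})) -
        marginal g i (B \<union> (T \<inter> {..<i}))"
      using assms by (intro sum_marginal_telescope) auto
    also have "(B \<union> (T \<inter> {..<i})) \<union> (T \<inter> {i..}) = B \<union> T"
      by auto
    finally show ?thesis .
  qed
  then show ?thesis
    using sum_marginal_telescope[OF assms, of g] by (simp add: sum_negf sum_subtractf)
qed


section \<open>The polynomial \<open>G1\<close> on the variety\<close>

lemma polys_deg_xys:
  assumes "i \<in> {1..n}"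
  shows "Defs.x i \<in> polys_deg (xys_vars n) 1" "Defs.y i \<in> polys_deg (xys_vars n) 1"
    "Defs.s i \<in> polys_deg (xys_vars n) 1"
  using assms by (auto intro: polys_deg_Var simp del: One_nat_def)

lemma polys_pdiff: "multilinear F \<Longrightarrow> F \<in> polys V \<Longrightarrow> pdiff i F \<in> polys (V - {i})"
  by (simp add: pdiff_multilinear polys_discrete_deriv)

lemma polys_G1:
  assumes F: "F \<in> polys {1..n}" "multilinear F"
  shows "G1 n F \<in> polys (xys_vars n)"
proof -
  have dF: "pdiff i F \<in> polys {1..n}" for i
    using polys_pdiff[OF F(2,1), of i] by (auto simp: polys_def)
  show ?thesis
    unfolding G1_def
    by (intro polys_diff polys_add polys_sum polys_mult polys_psubst[OF F(1)] polys_psubst[OF dF]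
        polys_degD[OF polys_deg_xys(1)] polys_degD[OF polys_deg_xys(2)]
        polys_degD[OF polys_deg_xys(3)] polys_deg_diff polys_deg_add polys_deg_xys)
qed

lemma peval_G1:
  assumes F: "multilinear F" and A: "A \<subseteq> {1..n}" and B: "B \<subseteq> {1..n}"
  defines "g \<equiv> \<lambda>U. peval (indicator_point U) F"
  shows "peval (xys_point A B) (G1 n F) =
    g A - g B + (\<Sum>i\<in>B - A. marginal g i A) - (\<Sum>i\<in>A - B. marginal g i (A \<union> B))"
proof -
  have pts: "(\<lambda>i. peval (xys_point A B) (Defs.x i)) = indicator_point A"
    "(\<lambda>i. peval (xys_point A B) (Defs.y i)) = indicator_point B"
    "(\<lambda>k. peval (xys_point A B) (Defs.x k + Defs.y k - Defs.s k)) = indicator_point (A \<union> B)"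
    by (auto simp: indicator_point_def)
  have "(\<Sum>i=1..n. (of_bool (i \<in> B) - of_bool (i \<in> A \<inter> B)) * marginal g i A) =
      (\<Sum>i\<in>B - A. marginal g i A)"
    using A B by (intro sum.mono_neutral_cong_right) auto
  moreover have "(\<Sum>i=1..n. (of_bool (i \<in> A) - of_bool (i \<in> A \<inter> B)) * marginal g i (A \<union> B)) =
      (\<Sum>i\<in>A - B. marginal g i (A \<union> B))"
    using A B by (intro sum.mono_neutral_cong_right) auto
  ultimately show ?thesis
    unfolding G1_def peval_add peval_diff peval_sum peval_mult peval_psubst pts[unfolded peval_add peval_diff]
      pdiff_multilinear[OF F] peval_indicator_discrete_deriv g_def
    by simp
qed

lemma peval_pdiff_pdiff:
  assumes "multilinear F"
  shows "peval (indicator_point A) (pdiff j (pdiff i F)) =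
    marginal (marginal (\<lambda>U. peval (indicator_point U) F) i) j A"
  using assms
  by (simp add: pdiff_multilinear multilinear_discrete_deriv peval_indicator_discrete_deriv)

lemma polys_pdiff_pdiff:
  assumes "multilinear F" "F \<in> polys V"
  shows "pdiff j (pdiff i F) \<in> polys (V - {j, i})"
proof -
  have "multilinear (pdiff i F)"
    using assms by (simp add: pdiff_multilinear multilinear_discrete_deriv)
  from polys_pdiff[OF this polys_pdiff[OF assms], of j] show ?thesis
    unfolding Diff_insert[of V j "{i}"] .
qed

text \<open>
  Pairs with \<open>j < i\<close> account for the marginals at \<open>A\<close>, pairs with \<open>i < j\<close> for those at \<open>A \<union> B\<close>.
  The substituted point is the indicator vector of \<open>A \<union> (B \<inter> {..<j})\<close> or \<open>B \<union> (A \<inter> {..<j})\<close>. The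
  factor in front says that \<open>i\<close> and \<open>j\<close> both lie in \<open>B - A\<close> or both in \<open>A - B\<close>; it is squared,
  without effect on its values, to fit \<open>sos_on_weighted_psubst\<close>.
\<close>

definition hessian_part :: "nat mpoly \<Rightarrow> nat \<Rightarrow> nat \<Rightarrow> xys mpoly" where
  "hessian_part F i j =
     (if j < i then ((Defs.y i - Defs.s i) * (Defs.y j - Defs.s j))\<^sup>2 *
        psubst (\<lambda>k. if k < j then Defs.x k + Defs.y k - Defs.s k else Defs.x k) (- pdiff j (pdiff i F))
      else if i < j then ((Defs.x i - Defs.s i) * (Defs.x j - Defs.s j))\<^sup>2 *
        psubst (\<lambda>k. if k < j then Defs.x k + Defs.y k - Defs.s k else Defs.y k) (- pdiff j (pdiff i F))
      else 0)"

lemma sum_of_bool_prod: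
  fixes h :: "nat \<Rightarrow> nat \<Rightarrow> real"
  assumes "T \<subseteq> {1..n}"
  shows "(\<Sum>i\<in>T. \<Sum>j\<in>T \<inter> R i. h i j) =
    (\<Sum>i=1..n. \<Sum>j=1..n. of_bool (i \<in> T \<and> j \<in> T \<and> j \<in> R i) * h i j)"
proof -
  have "(\<Sum>j=1..n. of_bool (i \<in> T \<and> j \<in> T \<and> j \<in> R i) * h i j) =
      of_bool (i \<in> T) * (\<Sum>j\<in>T \<inter> R i. h i j)" for i
  proof -
    have "(\<Sum>j=1..n. of_bool (j \<in> T \<and> j \<in> R i) * h i j) = (\<Sum>j\<in>T \<inter> R i. h i j)"
      using assms by (intro sum.mono_neutral_cong_right) auto
    then show ?thesis by auto
  qed
  then have "(\<Sum>i=1..n. \<Sum>j=1..n. of_bool (i \<in> T \<and> j \<in> T \<and> j \<in> R i) * h i j) =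
      (\<Sum>i=1..n. of_bool (i \<in> T) * (\<Sum>j\<in>T \<inter> R i. h i j))"
    by (simp only:)
  also have "\<dots> = (\<Sum>i\<in>T. \<Sum>j\<in>T \<inter> R i. h i j)"
    using assms by (intro sum.mono_neutral_cong_right) auto
  finally show ?thesis by simp
qed

text \<open>
  Insert \<open>g (A \<union> B)\<close> into \<open>G1\<close>: it splits into the excess of the marginals at \<open>A\<close> over
  \<open>g (A \<union> B) - g A\<close>, and the excess of \<open>g (A \<union> B) - g B\<close> over the marginals at \<open>A \<union> B\<close>.
\<close>

lemma peval_G1_eq_hessian_parts:
  assumes F: "multilinear F" and a: "a \<in> xys_points n"
  shows "peval a (G1 n F) = peval a (\<Sum>i=1..n. \<Sum>j=1..n. hessian_part F i j)"
proof -
  obtain A B where AB: "A \<subseteq> {1..n}" "B \<subseteq> {1..n}" and a: "a = xys_point A B"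
    using a by (auto simp: xys_points_def)
  define g where "g U = peval (indicator_point U) F" for U
  let ?P = "\<lambda>i j. - marginal (marginal g i) j (A \<union> ((B - A) \<inter> {..<j}))"
  let ?Q = "\<lambda>i j. - marginal (marginal g i) j (B \<union> ((A - B) \<inter> {..<j}))"
  have fin: "finite A" "finite B" using AB finite_subset by auto
  have part: "peval a (hessian_part F i j) =
      of_bool (i \<in> B - A \<and> j \<in> B - A \<and> j \<in> {..<i}) * ?P i j +
      of_bool (i \<in> A - B \<and> j \<in> A - B \<and> j \<in> {i<..}) * ?Q i j" for i j
  proof -
    have P: "(\<lambda>k. peval a (if k < j then Defs.x k + Defs.y k - Defs.s k else Defs.x k)) =
        indicator_point (A \<union> ((B - A) \<inter> {..<j}))"
      by (auto simp: a indicator_point_def)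
    have Q: "(\<lambda>k. peval a (if k < j then Defs.x k + Defs.y k - Defs.s k else Defs.y k)) =
        indicator_point (B \<union> ((A - B) \<inter> {..<j}))"
      by (auto simp: a indicator_point_def)
    consider "j < i" | "i < j" | "i = j" by linarith
    then show ?thesis
    proof cases
      case 1
      then have "hessian_part F i j = ((Defs.y i - Defs.s i) * (Defs.y j - Defs.s j))\<^sup>2 *
        psubst (\<lambda>k. if k < j then Defs.x k + Defs.y k - Defs.s k else Defs.x k) (- pdiff j (pdiff i F))"
        by (simp add: hessian_part_def)
      then have "peval a (hessian_part F i j) = ((of_bool (i \<in> B) - of_bool (i \<in> A \<inter> B)) *
          (of_bool (j \<in> B) - of_bool (j \<in> A \<inter> B)))\<^sup>2 * ?P i j"
        by (simp only: peval_mult peval_power peval_diff peval_Var peval_psubst P[unfolded a] peval_uminus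
            peval_pdiff_pdiff[OF F] g_def[abs_def] a xys_point.simps)
      with 1 show ?thesis by auto
    next
      case 2
      then have "hessian_part F i j = ((Defs.x i - Defs.s i) * (Defs.x j - Defs.s j))\<^sup>2 *
        psubst (\<lambda>k. if k < j then Defs.x k + Defs.y k - Defs.s k else Defs.y k) (- pdiff j (pdiff i F))"
        by (simp add: hessian_part_def)
      then have "peval a (hessian_part F i j) = ((of_bool (i \<in> A) - of_bool (i \<in> A \<inter> B)) *
          (of_bool (j \<in> A) - of_bool (j \<in> A \<inter> B)))\<^sup>2 * ?Q i j"
        by (simp only: peval_mult peval_power peval_diff peval_Var peval_psubst Q[unfolded a] peval_uminus
            peval_pdiff_pdiff[OF F] g_def[abs_def] a xys_point.simps)
      with 2 show ?thesis by auto
    qed (simp add: hessian_part_def)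
  qed
  have "peval a (G1 n F) =
      ((\<Sum>i\<in>B - A. marginal g i A) - (g (A \<union> (B - A)) - g A)) +
      ((g (B \<union> (A - B)) - g B) - (\<Sum>i\<in>A - B. marginal g i (B \<union> (A - B))))"
    unfolding a peval_G1[OF F AB] g_def[abs_def] by (simp add: Un_commute)
  also have "\<dots> = (\<Sum>i\<in>B - A. \<Sum>j\<in>(B - A) \<inter> {..<i}. ?P i j) + (\<Sum>i\<in>A - B. \<Sum>j\<in>(A - B) \<inter> {i<..}. ?Q i j)"
    using fin
    by (intro arg_cong2[where f = "(+)"] sum_marginal_minus_increment increment_minus_sum_marginal) auto
  also have "\<dots> = (\<Sum>i=1..n. \<Sum>j=1..n. peval a (hessian_part F i j))"
  proof -
    have "B - A \<subseteq> {1..n}" "A - B \<subseteq> {1..n}" using AB by auto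
    from this[THEN sum_of_bool_prod] show ?thesis
      unfolding part sum.distrib by (simp only:)
  qed
  finally show ?thesis by simp
qed

lemma sos_on_hessian_part:
  assumes F: "F \<in> polys {1..n}" "multilinear F" and ij: "i \<in> {1..n}" "j \<in> {1..n}" "i \<noteq> j"
    and sos: "sos_on t ({1..n} - {j, i}) (indicator_point ` Pow ({1..n} - {j, i}))
      (- pdiff j (pdiff i F))"
  shows "sos_on (t + 2) (xys_vars n) (xys_points n) (hessian_part F i j)"
proof -
  let ?V = "xys_vars n" and ?W = "{1..n} - {j, i}"
  have h: "- pdiff j (pdiff i F) \<in> polys ?W"
    by (intro polys_uminus polys_pdiff_pdiff F)
  have deg2: "p * q \<in> polys_deg ?V 2" if "p \<in> polys_deg ?V 1" "q \<in> polys_deg ?V 1" for p q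
    using polys_deg_mult[OF that] by (simp add: numeral_2_eq_2)
  have aff: "(if k < j then Defs.x k + Defs.y k - Defs.s k else Defs.x k) \<in> polys_deg ?V 1"
    "(if k < j then Defs.x k + Defs.y k - Defs.s k else Defs.y k) \<in> polys_deg ?V 1"
    if "k \<in> ?W" for k
    using that by (auto intro!: polys_deg_diff polys_deg_add polys_deg_xys simp del: One_nat_def)
  have bool: "peval a (if k < j then Defs.x k + Defs.y k - Defs.s k else Defs.x k) \<in> {0, 1}"
    "peval a (if k < j then Defs.x k + Defs.y k - Defs.s k else Defs.y k) \<in> {0, 1}"
    if "a \<in> xys_points n" for a k
    using that by (auto simp: xys_points_def)
  consider "j < i" | "i < j" using ij by linarith
  then show ?thesis
  proof cases
    case 1
    have "sos_on (t + 2) ?V (xys_points n) (((Defs.y i - Defs.s i) * (Defs.y j - Defs.s j))\<^sup>2 *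
        psubst (\<lambda>k. if k < j then Defs.x k + Defs.y k - Defs.s k else Defs.x k) (- pdiff j (pdiff i F)))"
      by (intro sos_on_weighted_psubst[OF sos h] aff bool deg2 polys_deg_diff polys_deg_xys ij)
    then show ?thesis using 1 by (simp add: hessian_part_def)
  next
    case 2
    have "sos_on (t + 2) ?V (xys_points n) (((Defs.x i - Defs.s i) * (Defs.x j - Defs.s j))\<^sup>2 *
        psubst (\<lambda>k. if k < j then Defs.x k + Defs.y k - Defs.s k else Defs.y k) (- pdiff j (pdiff i F)))"
      by (intro sos_on_weighted_psubst[OF sos h] aff bool deg2 polys_deg_diff polys_deg_xys ij)
    then show ?thesis using 2 by (simp add: hessian_part_def)
  qed
qed


section \<open>Recovering the Hessian entry from \<open>G1\<close>\<close>

lemma marginal_marginal: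
  assumes "i \<noteq> j"
  shows "marginal (marginal g i) j A =
     g (insert i (insert j A)) - g (insert j (A - {i})) - g (insert i (A - {j})) + g (A - {i, j})"
proof -
  have "insert j A - {i} = insert j (A - {i})" "A - {j} - {i} = A - {i, j}"
    using assms by blast+
  then show ?thesis unfolding marginal_def by simp
qed

text \<open>
  Here \<open>A \<subseteq> B\<close> and \<open>B - A \<subseteq> {i, j}\<close>, so \<open>G1\<close> is the excess of at most two marginals over their
  joint increment. This is the negated second difference if there are two of them, and 0 otherwise.
\<close>

lemma peval_G1_slice:
  assumes F: "multilinear F" and ij: "i \<noteq> j" and U: "U \<subseteq> {1..n}"
  defines "g \<equiv> \<lambda>U. peval (indicator_point U) F"
  shows "peval (xys_point (U - {i, j}) U) (G1 n F) =
    (if i \<in> U \<and> j \<in> U then - marginal (marginal g i) j (U - {i, j}) else 0)"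
proof -
  let ?A = "U - {i, j}"
  have "peval (xys_point ?A U) (G1 n F) = g ?A - g U + (\<Sum>k\<in>U \<inter> {i, j}. marginal g k ?A)"
  proof -
    have *: "U - (U - {i, j}) = U \<inter> {i, j}" "U - {i, j} - U = {}" by auto
    show ?thesis
      using peval_G1[OF F, of ?A n U] U unfolding * g_def by auto
  qed
  moreover consider "i \<in> U" "j \<in> U" | "i \<in> U" "j \<notin> U" | "i \<notin> U" "j \<in> U" | "i \<notin> U" "j \<notin> U" by blast
  then have "g ?A - g U + (\<Sum>k\<in>U \<inter> {i, j}. marginal g k ?A) =
    (if i \<in> U \<and> j \<in> U then - marginal (marginal g i) j ?A else 0)"
  proof cases
    case 1
    then have "U \<inter> {i, j} = {i, j}" "insert i (insert j ?A) = U" by auto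
    then show ?thesis using ij 1
      by (simp add: marginal_marginal) (simp add: marginal_def)
  next
    case 2
    then have "U \<inter> {i, j} = {i}" "insert i ?A = U" by auto
    then show ?thesis using 2 by (simp add: marginal_def)
  next
    case 3
    then have "U \<inter> {i, j} = {j}" "insert j ?A = U" by auto
    then show ?thesis using 3 by (simp add: marginal_def)
  next
    case 4
    then have "U \<inter> {i, j} = {}" "?A = U" by auto
    then show ?thesis using 4 by simp
  qed
  ultimately show ?thesis by simp
qed

text \<open>
  A sum of squares is 0 only if every summand is. This forces the squares for \<open>G1\<close>, restricted
  to the slice, to vanish at all \<open>U\<close> that do not contain both \<open>i\<close> and \<open>j\<close>, and leaves one of the
  four terms of their second difference.
\<close>

lemma sos_on_hessian_of_G1:
  assumes F: "F \<in> polys {1..n}" "multilinear F" and ij: "i \<in> {1..n}" "j \<in> {1..n}" "i \<noteq> j"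
    and sos: "sos_on (t + 2) (xys_vars n) (xys_points n) (G1 n F)"
  shows "sos_on t ({1..n} - {j, i}) (indicator_point ` Pow ({1..n} - {j, i})) (- pdiff j (pdiff i F))"
proof -
  let ?W = "{1..n} - {j, i}"
  define g where "g U = peval (indicator_point U) F" for U
  \<comment> \<open>The parametrisation of the slice \<open>A = U - {i, j}\<close>, \<open>B = U\<close>, \<open>A \<inter> B = A\<close>
      by the indicator vector of \<open>U\<close>.\<close>
  define \<sigma> :: "xys \<Rightarrow> nat mpoly" where "\<sigma> w = (case w of xys.X k \<Rightarrow> if k \<in> {i, j} then 0 else Var k
    | xys.Y k \<Rightarrow> Var k | xys.S k \<Rightarrow> if k \<in> {i, j} then 0 else Var k)" for w
  obtain qs where qs: "set qs \<subseteq> polys_deg (xys_vars n) (t + 2)"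
    and G: "\<And>a. a \<in> xys_points n \<Longrightarrow> peval a (G1 n F) = (\<Sum>q\<leftarrow>qs. (peval a q)\<^sup>2)"
    using sos unfolding sos_on_def by blast
  define r where "r q U = peval (indicator_point U) (psubst \<sigma> q)" for q U
  have r: "r q U = peval (xys_point (U - {i, j}) U) q" for q U
  proof -
    have "peval (indicator_point U) (\<sigma> w) = xys_point (U - {i, j}) U w" for w
      by (cases w) (auto simp: \<sigma>_def indicator_point_def)
    then show ?thesis by (simp add: r_def)
  qed
  have sum_r: "(\<Sum>q\<leftarrow>qs. (r q U)\<^sup>2) =
      (if i \<in> U \<and> j \<in> U then - marginal (marginal g i) j (U - {i, j}) else 0)" if "U \<subseteq> {1..n}" for U
  proof -
    have "xys_point (U - {i, j}) U \<in> xys_points n"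
      using that by (auto simp: xys_points_def)
    from G[OF this] show ?thesis
      unfolding r g_def[abs_def] by (simp add: peval_G1_slice[OF F(2) ij(3) that])
  qed
  \<comment> \<open>The value of \<open>q\<close> at the point of the slice given by \<open>U\<close> vanishes together with \<open>G1\<close>.\<close>
  have r_zero: "r q U = 0" if "q \<in> set qs" "U \<subseteq> {1..n}" "\<not> (i \<in> U \<and> j \<in> U)" for q U
  proof -
    have "(\<Sum>q\<leftarrow>qs. (r q U)\<^sup>2) = 0" using sum_r[OF that(2)] that(3) by simp
    then show ?thesis
      using that(1) by (subst (asm) sum_list_nonneg_eq_0_iff) auto
  qed
  have "set (map (\<lambda>q. discrete_deriv j (discrete_deriv i (psubst \<sigma> q))) qs) \<subseteq> polys_deg ?W t"
  proof clarify
    fix p assume "p \<in> set (map (\<lambda>q. discrete_deriv j (discrete_deriv i (psubst \<sigma> q))) qs)"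
    then obtain q where q: "q \<in> set qs" and p: "p = discrete_deriv j (discrete_deriv i (psubst \<sigma> q))"
      by auto
    have \<sigma>: "\<sigma> w \<in> polys_deg {1..n} 1" if "w \<in> xys_vars n" for w
      using that by (cases w)
        (auto simp: \<sigma>_def intro: polys_deg_Var polys_deg_zero simp del: One_nat_def)
    have "psubst \<sigma> q \<in> polys_deg {1..n} (t + 2)"
      using q qs \<sigma> by (intro polys_deg_psubst[of q "xys_vars n"]) auto
    then have "psubst \<sigma> q \<in> polys_deg {1..n} (Suc (Suc t))" by simp
    then have "p \<in> polys_deg ({1..n} - {i} - {j}) t"
      unfolding p by (intro polys_deg_discrete_deriv)
    then show "p \<in> polys_deg ?W t" unfolding Diff_insert[of _ j "{i}"] .
  qed
  moreover have "peval (indicator_point U) (- pdiff j (pdiff i F)) =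
      (\<Sum>q\<leftarrow>map (\<lambda>q. discrete_deriv j (discrete_deriv i (psubst \<sigma> q))) qs.
         (peval (indicator_point U) q)\<^sup>2)" if U: "U \<subseteq> ?W" for U
  proof -
    let ?U = "insert i (insert j U)"
    have val: "peval (indicator_point U) (discrete_deriv j (discrete_deriv i (psubst \<sigma> q))) = r q ?U"
      if "q \<in> set qs" for q
    proof -
      have "peval (indicator_point U) (discrete_deriv j (discrete_deriv i (psubst \<sigma> q))) =
          marginal (marginal (r q) i) j U"
        by (simp add: peval_indicator_discrete_deriv r_def[abs_def] del: peval_psubst)
      moreover have "r q (insert j (U - {i})) = 0" "r q (insert i (U - {j})) = 0" "r q (U - {i, j}) = 0"
        using U ij by (auto intro!: r_zero that)
      ultimately show ?thesis using ij by (simp add: marginal_marginal)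
    qed
    have "?U \<subseteq> {1..n}" "?U - {i, j} = U" using U ij by auto
    with sum_r[of ?U] have "(\<Sum>q\<leftarrow>qs. (r q ?U)\<^sup>2) = - marginal (marginal g i) j U" by simp
    moreover have "peval (indicator_point U) (- pdiff j (pdiff i F)) = - marginal (marginal g i) j U"
      by (simp add: peval_pdiff_pdiff[OF F(2)] g_def[abs_def])
    ultimately show ?thesis
      using val by (simp add: comp_def cong: map_cong)
  qed
  ultimately show ?thesis
    unfolding sos_on_def by blast
qed

theorem theorem5:
  fixes t n :: nat and f :: "nat set \<Rightarrow> real"
  shows "sos_submodular t n f \<longleftrightarrow> sos_mod (t + 2) (xys_vars n) (I0 n) (G1 n (mle n f))"
proof -
  define F where "F = mle n f"
  have F: "F \<in> polys {1..n}" "multilinear F"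
    using is_mle_mle[of n f] by (auto simp: F_def is_mle_def)
  let ?W = "\<lambda>i j. {1..n} - {i, j}"
  let ?sos = "\<lambda>i j. sos_on t (?W i j) (indicator_point ` Pow (?W i j)) (- pdiff i (pdiff j F))"
  have "sos_mod t (?W i j) (I2 (?W i j)) (- pdiff i (pdiff j F)) \<longleftrightarrow> ?sos i j" for i j
    by (intro sos_mod_iff_sos_on I2_iff polys_uminus polys_pdiff_pdiff F) auto
  then have lhs: "sos_submodular t n f \<longleftrightarrow> (\<forall>i\<in>{1..n}. \<forall>j\<in>{1..n}. i \<noteq> j \<longrightarrow> ?sos i j)"
    by (simp add: sos_submodular_def F_def)
  have rhs: "sos_mod (t + 2) (xys_vars n) (I0 n) (G1 n F) \<longleftrightarrow>
      sos_on (t + 2) (xys_vars n) (xys_points n) (G1 n F)"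
    by (intro sos_mod_iff_sos_on I0_iff polys_G1 F)
  have "sos_on (t + 2) (xys_vars n) (xys_points n) (G1 n F)"
    if sub: "\<forall>i\<in>{1..n}. \<forall>j\<in>{1..n}. i \<noteq> j \<longrightarrow> ?sos i j"
  proof -
    have "sos_on (t + 2) (xys_vars n) (xys_points n) (\<Sum>i=1..n. \<Sum>j=1..n. hessian_part F i j)"
    proof (intro sos_on_sum)
      fix i j assume "i \<in> {1..n}" "j \<in> {1..n}"
      then show "sos_on (t + 2) (xys_vars n) (xys_points n) (hessian_part F i j)"
        using sub sos_on_hessian_part[OF F, of i j t]
        by (cases "i = j") (auto simp: hessian_part_def sos_on_zero)
    qed
    then show ?thesis
      using sos_on_cong[OF peval_G1_eq_hessian_parts[OF F(2)]] by blast
  qed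
  moreover have "?sos i j" if "sos_on (t + 2) (xys_vars n) (xys_points n) (G1 n F)"
    "i \<in> {1..n}" "j \<in> {1..n}" "i \<noteq> j" for i j
    using that by (intro sos_on_hessian_of_G1[OF F]) auto
  ultimately show ?thesis
    unfolding lhs rhs F_def[symmetric] by blast
qed

end
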